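(* Let $X$ be a Zariski space. Then integration induces a duality $\mathcal{M}(X)\cong SC(X)^*$: the linear map $\Lambda\colon\mathcal{M}(X)\to SC(X)^*$, $\Lambda(\mu)(f)=\int_X f\,d\mu$, is an isomorphism of real vector spaces.
   Context: A topological space $X$ is Noetherian if every descending chain of closed subsets is eventually constant. A closed set $E\subseteq X$ is irreducible if it is not a union of two proper closed subsets. A Noetherian space $X$ is a Zariski space if every nonempty irreducible closed subset $E\subseteq X$ has a unique generic point, i.e. a unique point $x\in E$ with $\overline{\{x\}}=E$. $\mathcal{M}(X)$ is the real vector space of finite signed Borel measures on $X$. A function $g\colon X\to\mathbb{R}$ is upper semicontinuous if $\{x: g(x)\ge r\}$ is closed for all $r\in\mathbb{R}$. $SC(X)$ is the real vector space of functions $f\colon X\to\mathbb{R}$ of the form $f=g-h$ with $g,h$ bounded upper semicontinuous functions, normed by $\|f\|=\sup_X|f|$; $SC(X)^*$ is its continuous dual. *)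

theory Defs
  imports "HOL-Analysis.Analysis"
begin

definition noetherian_space :: "'a topology \<Rightarrow> bool" where
  "noetherian_space X \<longleftrightarrow>
    (\<forall>F :: nat \<Rightarrow> 'a set. (\<forall>n. closedin X (F n)) \<and> decseq F \<longrightarrow> (\<exists>N. \<forall>n\<ge>N. F n = F N))"

text \<open>With this convention the empty set is irreducible, hence the explicit nonemptiness
  condition in the next definition.\<close>

definition irreducible_closedin :: "'a topology \<Rightarrow> 'a set \<Rightarrow> bool" where
  "irreducible_closedin X E \<longleftrightarrow>
    closedin X E \<and> \<not> (\<exists>A B. closedin X A \<and> closedin X B \<and> A \<subset> E \<and> B \<subset> E \<and> E = A \<union> B)"

definition zariski_space :: "'a topology \<Rightarrow> bool" where
  "zariski_space X \<longleftrightarrow> noetherian_space X \<and>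
    (\<forall>E. irreducible_closedin X E \<and> E \<noteq> {} \<longrightarrow> (\<exists>!x. x \<in> E \<and> X closure_of {x} = E))"

text \<open>The vector spaces below are sets of real-valued functions on a type (points, sets of points
  or functions), with pointwise operations. Functions that are mathematically defined only on a
  subset of the type are represented by their extension by zero, so that equality of
  functions is equality on that subset.\<close>

definition real_fun_space :: "('b \<Rightarrow> real) set \<Rightarrow> bool" where
  "real_fun_space V \<longleftrightarrow> (\<lambda>_. 0) \<in> V \<and>
    (\<forall>u\<in>V. \<forall>v\<in>V. (\<lambda>x. u x + v x) \<in> V) \<and> (\<forall>c. \<forall>u\<in>V. (\<lambda>x. c * u x) \<in> V)"

definition real_linear_iso ::
  "('b \<Rightarrow> real) set \<Rightarrow> ('c \<Rightarrow> real) set \<Rightarrow> (('b \<Rightarrow> real) \<Rightarrow> ('c \<Rightarrow> real)) \<Rightarrow> bool" where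
  "real_linear_iso V W T \<longleftrightarrow> real_fun_space V \<and> real_fun_space W \<and>
    (\<forall>u\<in>V. \<forall>v\<in>V. T (\<lambda>x. u x + v x) = (\<lambda>y. T u y + T v y)) \<and>
    (\<forall>c. \<forall>u\<in>V. T (\<lambda>x. c * u x) = (\<lambda>y. c * T u y)) \<and>
    bij_betw T V W"

definition borel_sets :: "'a topology \<Rightarrow> 'a set set" where
  "borel_sets X = sigma_sets (topspace X) {U. openin X U}"

definition signed_measures :: "'a topology \<Rightarrow> ('a set \<Rightarrow> real) set" where
  "signed_measures X = {\<mu>. (\<forall>A. A \<notin> borel_sets X \<longrightarrow> \<mu> A = 0) \<and> \<mu> {} = 0 \<and>
    (\<forall>A :: nat \<Rightarrow> 'a set. range A \<subseteq> borel_sets X \<and> disjoint_family A \<longrightarrow>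
       (\<lambda>n. \<mu> (A n)) sums \<mu> (\<Union>n. A n))}"

text \<open>The positive part of the Jordan decomposition; the negative part is the positive part of
  \<open>- \<mu>\<close>. Since \<open>ennreal\<close> truncates negative reals to \<open>0 = \<mu> {}\<close>, the supremum is the
  usual one of \<open>\<mu> B\<close> over Borel subsets \<open>B\<close> of \<open>A\<close>.\<close>

definition pos_variation :: "'a topology \<Rightarrow> ('a set \<Rightarrow> real) \<Rightarrow> 'a measure" where
  "pos_variation X \<mu> = measure_of (topspace X) (borel_sets X)
     (\<lambda>A. SUP B\<in>{B \<in> borel_sets X. B \<subseteq> A}. ennreal (\<mu> B))"

definition signed_integral :: "'a topology \<Rightarrow> ('a set \<Rightarrow> real) \<Rightarrow> ('a \<Rightarrow> real) \<Rightarrow> real" where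
  "signed_integral X \<mu> f =
     (\<integral>x. f x \<partial>pos_variation X \<mu>) - (\<integral>x. f x \<partial>pos_variation X (\<lambda>A. - \<mu> A))"

definition usc_on :: "'a topology \<Rightarrow> ('a \<Rightarrow> real) \<Rightarrow> bool" where
  "usc_on X g \<longleftrightarrow> (\<forall>r. closedin X {x \<in> topspace X. g x \<ge> r})"

definition SC :: "'a topology \<Rightarrow> ('a \<Rightarrow> real) set" where
  "SC X = {f. (\<forall>x. x \<notin> topspace X \<longrightarrow> f x = 0) \<and>
    (\<exists>g h. usc_on X g \<and> bounded (g ` topspace X) \<and> usc_on X h \<and> bounded (h ` topspace X) \<and>
       (\<forall>x\<in>topspace X. f x = g x - h x))}"

text \<open>For elements of \<open>SC X\<close> the supremum over the whole type agrees with the one over the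
  space, because they vanish outside; it also gives the norm \<open>0\<close> when the space is empty.\<close>

definition sup_norm :: "('a \<Rightarrow> real) \<Rightarrow> real" where
  "sup_norm f = (SUP x. \<bar>f x\<bar>)"

text \<open>Metric spaces in the library require a distance that is nonnegative on the whole type, so
  it is set to \<open>0\<close> outside \<open>SC X\<close>, where the supremum could be ill-defined.\<close>

definition SC_dist :: "'a topology \<Rightarrow> ('a \<Rightarrow> real) \<Rightarrow> ('a \<Rightarrow> real) \<Rightarrow> real" where
  "SC_dist X f g = (if f \<in> SC X \<and> g \<in> SC X then sup_norm (\<lambda>x. f x - g x) else 0)"

definition SC_topology :: "'a topology \<Rightarrow> ('a \<Rightarrow> real) topology" where
  "SC_topology X = Metric_space.mtopology (SC X) (SC_dist X)"

definition SC_dual :: "'a topology \<Rightarrow> (('a \<Rightarrow> real) \<Rightarrow> real) set" where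
  "SC_dual X = {\<phi>. (\<forall>f. f \<notin> SC X \<longrightarrow> \<phi> f = 0) \<and>
    (\<forall>f\<in>SC X. \<forall>g\<in>SC X. \<phi> (\<lambda>x. f x + g x) = \<phi> f + \<phi> g) \<and>
    (\<forall>c. \<forall>f\<in>SC X. \<phi> (\<lambda>x. c * f x) = c * \<phi> f) \<and>
    continuous_map (SC_topology X) euclideanreal \<phi>}"

definition Lambda :: "'a topology \<Rightarrow> ('a set \<Rightarrow> real) \<Rightarrow> ('a \<Rightarrow> real) \<Rightarrow> real" where
  "Lambda X \<mu> = (\<lambda>f. if f \<in> SC X then signed_integral X \<mu> f else 0)"

lemma usc_on_const: "usc_on X (\<lambda>_. c)"
proof -
  have "{x \<in> topspace X. c \<ge> r} = (if c \<ge> r then topspace X else {})" for r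
    by auto
  then show ?thesis
    unfolding usc_on_def by simp
qed

lemma usc_on_iff_openin: "usc_on X g \<longleftrightarrow> (\<forall>r. openin X {x \<in> topspace X. g x < r})"
proof -
  have "topspace X - {x \<in> topspace X. g x \<ge> r} = {x \<in> topspace X. g x < r}" for r
    by auto
  then show ?thesis
    unfolding usc_on_def closedin_def by auto
qed

lemma usc_on_add:
  assumes "usc_on X g" "usc_on X h"
  shows "usc_on X (\<lambda>x. g x + h x)"
  unfolding usc_on_iff_openin
proof
  fix r
  have "\<exists>s. u < s \<and> v < r - s" if "u + v < r" for u v :: real
    using that by (intro exI[of _ "u + (r - u - v) / 2"]) (simp add: field_simps)
  then have "{x \<in> topspace X. g x + h x < r} =
      (\<Union>s. {x \<in> topspace X. g x < s} \<inter> {x \<in> topspace X. h x < r - s})"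
    by fastforce
  also have "openin X \<dots>"
    using assms unfolding usc_on_iff_openin by (blast intro: openin_Union openin_Int)
  finally show "openin X {x \<in> topspace X. g x + h x < r}" .
qed

lemma usc_on_scale:
  assumes "usc_on X g" "c \<ge> 0"
  shows "usc_on X (\<lambda>x. c * g x)"
proof (cases "c = 0")
  case True
  then show ?thesis
    by (simp add: usc_on_const)
next
  case False
  then have "{x \<in> topspace X. c * g x \<ge> r} = {x \<in> topspace X. g x \<ge> r / c}" for r
    using assms(2) by (auto simp: field_simps)
  then show ?thesis
    using assms(1) unfolding usc_on_def by simp
qed

lemma SC_I:
  assumes "usc_on X g" "bounded (g ` topspace X)" "usc_on X h" "bounded (h ` topspace X)"
    "\<And>x. x \<in> topspace X \<Longrightarrow> f x = g x - h x" "\<And>x. x \<notin> topspace X \<Longrightarrow> f x = 0"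
  shows "f \<in> SC X"
  using assms unfolding SC_def by blast

lemma SC_E:
  assumes "f \<in> SC X"
  obtains g h where "usc_on X g" "bounded (g ` topspace X)" "usc_on X h" "bounded (h ` topspace X)"
    "\<And>x. x \<in> topspace X \<Longrightarrow> f x = g x - h x" "\<And>x. x \<notin> topspace X \<Longrightarrow> f x = 0"
  using assms unfolding SC_def by blast

lemma bounded_scale_image:
  assumes "bounded (g ` S)"
  shows "bounded ((\<lambda>x. c * g x :: real) ` S)"
  using bounded_scaleR_comp[OF assms, of c] by simp

lemma real_fun_space_SC: "real_fun_space (SC X)"
  unfolding real_fun_space_def
proof (intro conjI ballI allI)
  show "(\<lambda>_. 0) \<in> SC X"
    by (rule SC_I[where g = "\<lambda>_. 0" and h = "\<lambda>_. 0"])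
      (auto simp: usc_on_const bounded_iff)
next
  fix f f' assume "f \<in> SC X" "f' \<in> SC X"
  from \<open>f \<in> SC X\<close> obtain g h where 1:
    "usc_on X g" "bounded (g ` topspace X)" "usc_on X h" "bounded (h ` topspace X)"
    "\<And>x. x \<in> topspace X \<Longrightarrow> f x = g x - h x" "\<And>x. x \<notin> topspace X \<Longrightarrow> f x = 0"
    by (rule SC_E) blast
  from \<open>f' \<in> SC X\<close> obtain g' h' where 2:
    "usc_on X g'" "bounded (g' ` topspace X)" "usc_on X h'" "bounded (h' ` topspace X)"
    "\<And>x. x \<in> topspace X \<Longrightarrow> f' x = g' x - h' x" "\<And>x. x \<notin> topspace X \<Longrightarrow> f' x = 0"
    by (rule SC_E) blast
  show "(\<lambda>x. f x + f' x) \<in> SC X"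
    by (rule SC_I[where g = "\<lambda>x. g x + g' x" and h = "\<lambda>x. h x + h' x"])
      (use 1 2 in \<open>auto intro: usc_on_add bounded_plus_comp\<close>)
next
  fix c f assume "f \<in> SC X"
  then obtain g h where 1:
    "usc_on X g" "bounded (g ` topspace X)" "usc_on X h" "bounded (h ` topspace X)"
    "\<And>x. x \<in> topspace X \<Longrightarrow> f x = g x - h x" "\<And>x. x \<notin> topspace X \<Longrightarrow> f x = 0"
    by (rule SC_E) blast
  show "(\<lambda>x. c * f x) \<in> SC X"
  proof (cases "c \<ge> 0")
    case True
    show ?thesis
      by (rule SC_I[where g = "\<lambda>x. c * g x" and h = "\<lambda>x. c * h x"])
        (use 1 True in \<open>auto intro: usc_on_scale bounded_scale_image simp: right_diff_distrib\<close>)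
  next
    case False
    then have "0 \<le> - c"
      by simp
    have *: "usc_on X (\<lambda>x. (- c) * h x)" "usc_on X (\<lambda>x. (- c) * g x)"
      using 1 \<open>0 \<le> - c\<close> by (blast intro: usc_on_scale)+
    have **: "bounded ((\<lambda>x. (- c) * h x) ` topspace X)" "bounded ((\<lambda>x. (- c) * g x) ` topspace X)"
      using 1 by (blast intro: bounded_scale_image)+
    show ?thesis
      by (rule SC_I[OF *(1) **(1) *(2) **(2)]) (simp_all add: 1 algebra_simps)
  qed
qed

lemma SC_diff:
  assumes "f \<in> SC X" "g \<in> SC X"
  shows "(\<lambda>x. f x - g x) \<in> SC X"
proof -
  have "(\<lambda>x. (- 1) * g x) \<in> SC X"
    using assms real_fun_space_SC unfolding real_fun_space_def by blast
  moreover have "\<forall>u\<in>SC X. \<forall>v\<in>SC X. (\<lambda>x. u x + v x) \<in> SC X"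
    using real_fun_space_SC unfolding real_fun_space_def by blast
  ultimately have "(\<lambda>x. f x + (- 1) * g x) \<in> SC X"
    using assms(1) by (auto dest: bspec)
  then show ?thesis
    by simp
qed

lemma SC_bdd_above:
  assumes "f \<in> SC X"
  shows "bdd_above (range (\<lambda>x. \<bar>f x\<bar>))"
proof -
  obtain g h where 1: "bounded (g ` topspace X)" "bounded (h ` topspace X)"
    "\<And>x. x \<in> topspace X \<Longrightarrow> f x = g x - h x" "\<And>x. x \<notin> topspace X \<Longrightarrow> f x = 0"
    using assms by (rule SC_E) blast
  obtain a b where "\<And>x. x \<in> topspace X \<Longrightarrow> \<bar>g x\<bar> \<le> a" "\<And>x. x \<in> topspace X \<Longrightarrow> \<bar>h x\<bar> \<le> b"
    using 1(1,2) unfolding bounded_iff by auto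
  then have "\<bar>f x\<bar> \<le> \<bar>a\<bar> + \<bar>b\<bar>" for x
    using 1(3,4)[of x] by (cases "x \<in> topspace X") (fastforce, simp)
  then show ?thesis
    by (intro bdd_aboveI2)
qed

lemma abs_le_sup_norm: "f \<in> SC X \<Longrightarrow> \<bar>f x\<bar> \<le> sup_norm f"
  unfolding sup_norm_def by (rule cSUP_upper) (auto intro: SC_bdd_above)

lemma sup_norm_le: "(\<And>x. \<bar>f x\<bar> \<le> c) \<Longrightarrow> sup_norm f \<le> c"
  unfolding sup_norm_def by (rule cSUP_least) auto

lemma Metric_space_SC: "Metric_space (SC X) (SC_dist X)"
proof
  fix f g :: "'a \<Rightarrow> real"
  show "0 \<le> SC_dist X f g"
    using abs_le_sup_norm[OF SC_diff, of f X g] unfolding SC_dist_def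
    by (auto intro: order_trans[OF abs_ge_zero])
  show "SC_dist X f g = SC_dist X g f"
    by (simp add: SC_dist_def sup_norm_def abs_minus_commute)
next
  fix f g assume fg: "f \<in> SC X" "g \<in> SC X"
  show "SC_dist X f g = 0 \<longleftrightarrow> f = g"
  proof
    assume "SC_dist X f g = 0"
    then have "\<bar>f x - g x\<bar> \<le> 0" for x
      using abs_le_sup_norm[OF SC_diff[OF fg], of x] fg by (simp add: SC_dist_def)
    then show "f = g"
      by (simp add: fun_eq_iff)
  qed (use fg in \<open>simp add: SC_dist_def sup_norm_def\<close>)
next
  fix f g h assume fgh: "f \<in> SC X" "g \<in> SC X" "h \<in> SC X"
  have "sup_norm (\<lambda>x. f x - h x) \<le> sup_norm (\<lambda>x. f x - g x) + sup_norm (\<lambda>x. g x - h x)"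
  proof (rule sup_norm_le)
    fix x
    show "\<bar>f x - h x\<bar> \<le> sup_norm (\<lambda>x. f x - g x) + sup_norm (\<lambda>x. g x - h x)"
      using abs_le_sup_norm[OF SC_diff[OF fgh(1,2)], of x]
        abs_le_sup_norm[OF SC_diff[OF fgh(2,3)], of x] by linarith
  qed
  then show "SC_dist X f h \<le> SC_dist X f g + SC_dist X g h"
    using fgh by (simp add: SC_dist_def)
qed

end

theory Submission
  imports Defs
begin

text \<open>
  Bounded functionals on \<open>SC X\<close> are determined by their values on indicators of closed sets, and
  \<open>\<Lambda> \<mu>\<close> takes the value \<open>\<mu> E\<close> at the indicator of \<open>E\<close>; since the closed sets generate the Borel
  sets, this gives linearity and injectivity. For surjectivity one shows that a bounded functional
  \<open>\<phi>\<close> is a sum of point evaluations. Its mass \<open>c x\<close> at a point \<open>x\<close> is a cluster value of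
  \<open>\<phi>\<close> at the indicators of \<open>X closure_of {x} - G\<close>, where \<open>G\<close> runs through the directed family of closed
  subsets of \<open>X closure_of {x}\<close> that miss \<open>x\<close>. The masses are absolutely summable, and Noetherian
  induction shows that the value of \<open>\<phi>\<close> at the indicator of a closed set \<open>E\<close> is the sum of \<open>c\<close> over
  \<open>E\<close>: for irreducible \<open>E\<close> with generic point \<open>x\<close>, finitely many other points of \<open>E\<close> always lie in a
  closed subset that misses \<open>x\<close>, so that the cluster value is in fact a limit.
\<close>

section \<open>Borel sets\<close>

lemma sigma_algebra_borel_sets: "sigma_algebra (topspace X) (borel_sets X)"
  unfolding borel_sets_def by (rule sigma_algebra_sigma_sets) (auto dest: openin_subset)

lemma borel_sets_closedin: "closedin X E \<Longrightarrow> E \<in> borel_sets X"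
proof -
  assume E: "closedin X E"
  interpret sigma_algebra "topspace X" "borel_sets X"
    by (rule sigma_algebra_borel_sets)
  have "topspace X - E \<in> borel_sets X"
    using E unfolding borel_sets_def closedin_def by auto
  then have "topspace X - (topspace X - E) \<in> borel_sets X"
    by (rule compl_sets)
  then show ?thesis
    using closedin_subset[OF E] by (simp add: Diff_Diff_Int inf_absorb2)
qed

subsection \<open>Signed measures\<close>

lemma signed_measure_sums:
  "\<mu> \<in> signed_measures X \<Longrightarrow> range A \<subseteq> borel_sets X \<Longrightarrow> disjoint_family A \<Longrightarrow>
    (\<lambda>n. \<mu> (A n)) sums \<mu> (\<Union>n. A n)"
  unfolding signed_measures_def by blast

lemma signed_measure_empty: "\<mu> \<in> signed_measures X \<Longrightarrow> \<mu> {} = 0"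
  unfolding signed_measures_def by blast

lemma signed_measure_Un:
  assumes "\<mu> \<in> signed_measures X" "A \<in> borel_sets X" "B \<in> borel_sets X" "A \<inter> B = {}"
  shows "\<mu> (A \<union> B) = \<mu> A + \<mu> B"
proof -
  interpret sigma_algebra "topspace X" "borel_sets X"
    by (rule sigma_algebra_borel_sets)
  have "(\<lambda>n. \<mu> (binaryset A B n)) sums \<mu> (\<Union>n. binaryset A B n)"
    by (rule signed_measure_sums[OF assms(1)])
      (use assms in \<open>auto simp: range_binaryset_eq disjoint_family_on_def binaryset_def\<close>)
  moreover have "(\<lambda>n. \<mu> (binaryset A B n)) sums (\<mu> A + \<mu> B)"
    by (rule binaryset_sums) (rule signed_measure_empty[OF assms(1)])
  ultimately show ?thesis
    by (simp add: UN_binaryset_eq sums_unique2)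
qed

lemma signed_measure_Diff:
  assumes "\<mu> \<in> signed_measures X" "A \<in> borel_sets X" "B \<in> borel_sets X" "B \<subseteq> A"
  shows "\<mu> (A - B) = \<mu> A - \<mu> B"
proof -
  interpret sigma_algebra "topspace X" "borel_sets X"
    by (rule sigma_algebra_borel_sets)
  have "\<mu> ((A - B) \<union> B) = \<mu> (A - B) + \<mu> B"
    by (rule signed_measure_Un) (use assms in auto)
  moreover have "(A - B) \<union> B = A"
    using assms by auto
  ultimately show ?thesis
    by simp
qed

lemma signed_measures_cmult:
  assumes "\<mu> \<in> signed_measures X"
  shows "(\<lambda>A. c * \<mu> A) \<in> signed_measures X"
  using assms unfolding signed_measures_def by (auto intro: sums_mult)

lemma signed_measures_uminus:
  "\<mu> \<in> signed_measures X \<Longrightarrow> (\<lambda>A. - \<mu> A) \<in> signed_measures X"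
  using signed_measures_cmult[of \<mu> X "-1"] by simp

lemma signed_measures_add:
  assumes "\<mu> \<in> signed_measures X" "\<nu> \<in> signed_measures X"
  shows "(\<lambda>A. \<mu> A + \<nu> A) \<in> signed_measures X"
  using assms unfolding signed_measures_def by (auto intro: sums_add)

text \<open>If \<open>\<mu>\<close> is unbounded on the subsets of \<open>A\<close>, then \<open>A\<close> contains a set \<open>E\<close> with both
  \<open>\<mu> E\<close> and \<open>\<mu> (A - E)\<close> large, and \<open>\<mu>\<close> remains unbounded on one of the two. Iterating gives
  a decreasing sequence along which \<open>\<mu>\<close> diverges.\<close>

lemma signed_measure_bounded:
  assumes \<mu>: "\<mu> \<in> signed_measures X"
  obtains K where "\<And>A. A \<in> borel_sets X \<Longrightarrow> \<bar>\<mu> A\<bar> \<le> K"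
proof -
  interpret sigma_algebra "topspace X" "borel_sets X"
    by (rule sigma_algebra_borel_sets)
  define ubd where "ubd A \<longleftrightarrow> (\<forall>K. \<exists>B\<in>borel_sets X. B \<subseteq> A \<and> \<bar>\<mu> B\<bar> > K)" for A
  have ubd_Un: "ubd E \<or> ubd F" if U: "ubd (E \<union> F)" and "E \<in> borel_sets X" "F \<in> borel_sets X" "E \<inter> F = {}" for E F
  proof (rule ccontr)
    assume "\<not> (ubd E \<or> ubd F)"
    then have n: "\<not> ubd E" "\<not> ubd F"
      by auto
    obtain K where K: "\<forall>B\<in>borel_sets X. B \<subseteq> E \<longrightarrow> \<bar>\<mu> B\<bar> \<le> K"
      using n(1) unfolding ubd_def by (auto simp: not_less)
    obtain L where L: "\<forall>B\<in>borel_sets X. B \<subseteq> F \<longrightarrow> \<bar>\<mu> B\<bar> \<le> L"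
      using n(2) unfolding ubd_def by (auto simp: not_less)
    obtain B where B: "B \<in> borel_sets X" "B \<subseteq> E \<union> F" "\<bar>\<mu> B\<bar> > K + L"
      using spec[OF U[unfolded ubd_def], of "K + L"] by blast
    have "\<mu> ((B \<inter> E) \<union> (B \<inter> F)) = \<mu> (B \<inter> E) + \<mu> (B \<inter> F)"
      by (rule signed_measure_Un[OF \<mu>]) (use B that in auto)
    moreover have "(B \<inter> E) \<union> (B \<inter> F) = B"
      using B by auto
    ultimately have "\<mu> B = \<mu> (B \<inter> E) + \<mu> (B \<inter> F)"
      by simp
    moreover have "\<bar>\<mu> (B \<inter> E)\<bar> \<le> K" "\<bar>\<mu> (B \<inter> F)\<bar> \<le> L"
      using K L B that by auto
    ultimately show False
      using B(3) by linarith
  qed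
  have "\<not> ubd (topspace X)"
  proof
    assume "ubd (topspace X)"
    have "\<exists>f. \<forall>n::nat. (f n \<in> borel_sets X \<and> ubd (f n) \<and> real n \<le> \<bar>\<mu> (f n)\<bar>) \<and> f (Suc n) \<subseteq> f n"
    proof (rule dependent_nat_choice)
      show "\<exists>A. A \<in> borel_sets X \<and> ubd A \<and> real 0 \<le> \<bar>\<mu> A\<bar>"
        using \<open>ubd (topspace X)\<close> by auto
    next
      fix A n assume A: "A \<in> borel_sets X \<and> ubd A \<and> real n \<le> \<bar>\<mu> A\<bar>"
      \<comment> \<open>The term \<open>\<bar>\<mu> A\<bar>\<close> in the bound makes
        \<open>\<mu> (A - E) = \<mu> A - \<mu> E\<close> at least \<open>Suc n\<close> in absolute
        value as well, so whichever piece inherits unboundedness can serve as the next set.\<close>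
      then obtain E where E: "E \<in> borel_sets X" "E \<subseteq> A" "\<bar>\<mu> E\<bar> > real (Suc n) + \<bar>\<mu> A\<bar>"
        using spec[OF conjunct1[OF conjunct2[OF A], unfolded ubd_def], of "real (Suc n) + \<bar>\<mu> A\<bar>"]
        by blast
      have AE: "A - E \<in> borel_sets X"
        using A E by auto
      have "\<mu> (A - E) = \<mu> A - \<mu> E"
        using A E by (intro signed_measure_Diff[OF \<mu>]) auto
      then have "\<bar>\<mu> (A - E)\<bar> \<ge> real (Suc n)"
        using E(3) by linarith
      moreover have "\<bar>\<mu> E\<bar> \<ge> real (Suc n)"
        using E(3) by linarith
      moreover have "ubd E \<or> ubd (A - E)"
        using ubd_Un[of E "A - E"] A E AE by (simp add: Un_absorb1)
      ultimately show "\<exists>B. (B \<in> borel_sets X \<and> ubd B \<and> real (Suc n) \<le> \<bar>\<mu> B\<bar>) \<and> B \<subseteq> A"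
        using AE E(1,2) Diff_subset[of A E] by metis
    qed
    then obtain f where f: "\<And>n. f n \<in> borel_sets X" "\<And>n. real n \<le> \<bar>\<mu> (f n)\<bar>"
      "\<And>n. f (Suc n) \<subseteq> f n"
      by blast
    have "decseq f"
      using f(3) by (rule decseq_SucI)
    have disj: "(f i - f (Suc i)) \<inter> (f j - f (Suc j)) = {}" if "i < j" for i j
      using decseqD[OF \<open>decseq f\<close>, of "Suc i" j] that by auto
    have "disjoint_family (\<lambda>n. f n - f (Suc n))"
      unfolding disjoint_family_on_def
    proof (intro ballI impI)
      fix i j :: nat assume "i \<noteq> j"
      then show "(f i - f (Suc i)) \<inter> (f j - f (Suc j)) = {}"
        using disj[of i j] disj[of j i] by (cases "i < j") (auto simp: Int_commute)
    qed
    \<comment> \<open>Countable additivity on the disjoint differences makes a telescoping series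
      converge, so \<open>\<mu> (f n)\<close> stays bounded, against
      \<open>real n \<le> \<bar>\<mu> (f n)\<bar>\<close>.\<close>
    then have "(\<lambda>n. \<mu> (f n - f (Suc n))) sums \<mu> (\<Union>n. f n - f (Suc n))"
      by (rule signed_measure_sums[OF \<mu>, rotated]) (use f in auto)
    moreover have "\<mu> (f n - f (Suc n)) = \<mu> (f n) - \<mu> (f (Suc n))" for n
      by (rule signed_measure_Diff[OF \<mu>]) (use f in auto)
    ultimately have "convergent (\<lambda>n. \<Sum>i<n. \<mu> (f i) - \<mu> (f (Suc i)))"
      unfolding sums_def convergent_def by auto
    then have "Bseq (\<lambda>n. \<mu> (f 0) - \<mu> (f n))"
      unfolding sum_lessThan_telescope'[of "\<lambda>i. \<mu> (f i)"] by (rule convergent_imp_Bseq)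
    then obtain K where K: "\<And>n. \<bar>\<mu> (f 0) - \<mu> (f n)\<bar> \<le> K"
      unfolding Bseq_def by auto
    obtain n where "real n > K + \<bar>\<mu> (f 0)\<bar>"
      using reals_Archimedean2 by blast
    then show False
      using K[of n] f(2)[of n] by linarith
  qed
  then obtain K where K: "\<And>B. B \<in> borel_sets X \<Longrightarrow> B \<subseteq> topspace X \<Longrightarrow> \<bar>\<mu> B\<bar> \<le> K"
    unfolding ubd_def by (auto simp: not_less)
  show ?thesis
    by (rule that[of K]) (use K sets_into_space in blast)
qed

section \<open>Jordan decomposition\<close>

text \<open>The set function inside \<open>pos_variation\<close>, named separately because
  \<open>measure_of\<close> takes it as the measure only once it is known to be countably
  additive.\<close>

definition upper_variation :: "'a topology \<Rightarrow> ('a set \<Rightarrow> real) \<Rightarrow> 'a set \<Rightarrow> ennreal" where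
  "upper_variation X \<mu> A = (SUP B\<in>{B \<in> borel_sets X. B \<subseteq> A}. ennreal (\<mu> B))"

lemma upper_variation_upper:
  "B \<in> borel_sets X \<Longrightarrow> B \<subseteq> A \<Longrightarrow> ennreal (\<mu> B) \<le> upper_variation X \<mu> A"
  unfolding upper_variation_def by (rule SUP_upper) auto

lemma upper_variation_least:
  "(\<And>B. B \<in> borel_sets X \<Longrightarrow> B \<subseteq> A \<Longrightarrow> ennreal (\<mu> B) \<le> c) \<Longrightarrow> upper_variation X \<mu> A \<le> c"
  unfolding upper_variation_def by (rule SUP_least) auto

lemma upper_variation_empty:
  assumes "\<mu> \<in> signed_measures X"
  shows "upper_variation X \<mu> {} = 0"
proof -
  have "upper_variation X \<mu> {} \<le> 0"
    by (rule upper_variation_least) (use signed_measure_empty[OF assms] in auto)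
  then show ?thesis
    by simp
qed

text \<open>Borel subsets of \<open>A\<close> and of \<open>B\<close> combine into a disjoint union
  inside \<open>A \<union> B\<close>, where \<open>\<mu>\<close> is additive; suprema over both give
  superadditivity.\<close>

lemma upper_variation_Un:
  assumes \<mu>: "\<mu> \<in> signed_measures X" and "A \<inter> B = {}"
  shows "upper_variation X \<mu> A + upper_variation X \<mu> B \<le> upper_variation X \<mu> (A \<union> B)"
proof -
  interpret sigma_algebra "topspace X" "borel_sets X"
    by (rule sigma_algebra_borel_sets)
  have ne: "{B \<in> borel_sets X. B \<subseteq> A} \<noteq> {}" "{A \<in> borel_sets X. A \<subseteq> B} \<noteq> {}"
    by auto
  have *: "ennreal (\<mu> C) + ennreal (\<mu> D) \<le> upper_variation X \<mu> (A \<union> B)"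
    if C: "C \<in> borel_sets X" "C \<subseteq> A" and D: "D \<in> borel_sets X" "D \<subseteq> B" for C D
  proof -
    \<comment> \<open>Negative values are truncated by \<open>ennreal\<close>, so a piece of
      nonpositive mass is simply dropped; only two nonnegative values are added through
      \<open>\<mu> (C \<union> D)\<close>.\<close>
    consider "\<mu> C \<le> 0" | "\<mu> D \<le> 0" | "\<mu> C \<ge> 0" "\<mu> D \<ge> 0"
      by linarith
    then show ?thesis
    proof cases
      case 1
      then show ?thesis
        using upper_variation_upper[of D X "A \<union> B" \<mu>] D by (auto simp: ennreal_neg)
    next
      case 2
      then show ?thesis
        using upper_variation_upper[of C X "A \<union> B" \<mu>] C by (auto simp: ennreal_neg)
    next
      case 3
      have "\<mu> (C \<union> D) = \<mu> C + \<mu> D"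
        by (rule signed_measure_Un[OF \<mu>]) (use assms C D in auto)
      then have "ennreal (\<mu> C) + ennreal (\<mu> D) = ennreal (\<mu> (C \<union> D))"
        using 3 by (simp add: ennreal_plus)
      also have "\<dots> \<le> upper_variation X \<mu> (A \<union> B)"
        by (rule upper_variation_upper) (use C D in auto)
      finally show ?thesis .
    qed
  qed
  have "upper_variation X \<mu> A + upper_variation X \<mu> B =
      (SUP C\<in>{B \<in> borel_sets X. B \<subseteq> A}. SUP D\<in>{A \<in> borel_sets X. A \<subseteq> B}. ennreal (\<mu> C) + ennreal (\<mu> D))"
    unfolding upper_variation_def
    unfolding ennreal_SUP_add_left[OF ne(1), symmetric] ennreal_SUP_add_right[OF ne(2)]
    by (rule SUP_commute)
  also have "\<dots> \<le> upper_variation X \<mu> (A \<union> B)"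
    by (intro SUP_least) (use * in auto)
  finally show ?thesis .
qed

text \<open>One inequality is superadditivity passed to partial sums. For the other, a Borel subset
  \<open>B\<close> of the union is cut into the pieces \<open>B \<inter> A i\<close>, each bounded
  by the variation of its \<open>A i\<close>.\<close>

lemma countably_additive_upper_variation:
  assumes \<mu>: "\<mu> \<in> signed_measures X"
  shows "countably_additive (borel_sets X) (upper_variation X \<mu>)"
  unfolding countably_additive_def
proof (intro allI impI antisym)
  interpret sigma_algebra "topspace X" "borel_sets X"
    by (rule sigma_algebra_borel_sets)
  fix A :: "nat \<Rightarrow> _"
  assume A: "range A \<subseteq> borel_sets X" "disjoint_family A"
  have "(\<Sum>i<n. upper_variation X \<mu> (A i)) \<le> upper_variation X \<mu> (\<Union>i<n. A i)" for n
  proof (induction n)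
    case 0
    then show ?case by simp
  next
    case (Suc n)
    have "(\<Sum>i<Suc n. upper_variation X \<mu> (A i)) \<le>
        upper_variation X \<mu> (\<Union>i<n. A i) + upper_variation X \<mu> (A n)"
      using Suc by (simp add: add_right_mono)
    also have "\<dots> \<le> upper_variation X \<mu> ((\<Union>i<n. A i) \<union> A n)"
    proof (rule upper_variation_Un[OF \<mu>])
      have "A i \<inter> A n = {}" if "i < n" for i
        using A(2) that unfolding disjoint_family_on_def by auto
      then show "(\<Union>i<n. A i) \<inter> A n = {}"
        by auto
    qed
    also have "(\<Union>i<n. A i) \<union> A n = (\<Union>i<Suc n. A i)"
      by (auto simp: lessThan_Suc)
    finally show ?case .
  qed
  also have "upper_variation X \<mu> (\<Union>i<n. A i) \<le> upper_variation X \<mu> (\<Union>i. A i)" for n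
    by (intro upper_variation_least upper_variation_upper) auto
  finally show "(\<Sum>i. upper_variation X \<mu> (A i)) \<le> upper_variation X \<mu> (\<Union>i. A i)"
    by (intro suminf_le_const) auto
  show "upper_variation X \<mu> (\<Union>i. A i) \<le> (\<Sum>i. upper_variation X \<mu> (A i))"
  proof (rule upper_variation_least)
    fix B assume B: "B \<in> borel_sets X" "B \<subseteq> (\<Union>i. A i)"
    have "(\<lambda>i. \<mu> (B \<inter> A i)) sums \<mu> (\<Union>i. B \<inter> A i)"
      by (rule signed_measure_sums[OF \<mu>])
        (use A B in \<open>auto simp: disjoint_family_on_def\<close>)
    moreover have "(\<Union>i. B \<inter> A i) = B"
      using B by auto
    ultimately have "(\<lambda>n. ennreal (\<Sum>i<n. \<mu> (B \<inter> A i))) \<longlonglongrightarrow> ennreal (\<mu> B)"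
      unfolding sums_def by auto
    moreover have "ennreal (\<Sum>i<n. \<mu> (B \<inter> A i)) \<le> (\<Sum>i. upper_variation X \<mu> (A i))" for n
    proof -
      \<comment> \<open>\<open>ennreal\<close> commutes with sums of nonnegative reals only, hence
        the passage to \<open>max 0\<close> before it is moved inside.\<close>
      have "ennreal (\<Sum>i<n. \<mu> (B \<inter> A i)) \<le> ennreal (\<Sum>i<n. max 0 (\<mu> (B \<inter> A i)))"
        by (intro ennreal_leI sum_mono) auto
      also have "\<dots> = (\<Sum>i<n. ennreal (max 0 (\<mu> (B \<inter> A i))))"
        by (rule sum_ennreal[symmetric]) auto
      also have "\<dots> \<le> (\<Sum>i<n. upper_variation X \<mu> (A i))"
      proof (rule sum_mono)
        fix i
        have "B \<inter> A i \<in> borel_sets X"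
          using A B by auto
        then show "ennreal (max 0 (\<mu> (B \<inter> A i))) \<le> upper_variation X \<mu> (A i)"
          using upper_variation_upper[of "B \<inter> A i" X "A i" \<mu>] by (auto simp: max_def)
      qed
      also have "\<dots> \<le> (\<Sum>i. upper_variation X \<mu> (A i))"
        by (rule sum_le_suminf) auto
      finally show ?thesis .
    qed
    ultimately show "ennreal (\<mu> B) \<le> (\<Sum>i. upper_variation X \<mu> (A i))"
      by (intro LIMSEQ_le_const2) auto
  qed
qed

lemma space_pos_variation [simp]: "space (pos_variation X \<mu>) = topspace X"
  unfolding pos_variation_def
  using sigma_algebra.space_measure_of_eq[OF sigma_algebra_borel_sets] .

lemma sets_pos_variation [simp]: "sets (pos_variation X \<mu>) = borel_sets X"
  unfolding pos_variation_def
  using sigma_algebra.sets_measure_of_eq[OF sigma_algebra_borel_sets] .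

lemma emeasure_pos_variation:
  assumes \<mu>: "\<mu> \<in> signed_measures X" and A: "A \<in> borel_sets X"
  shows "emeasure (pos_variation X \<mu>) A = upper_variation X \<mu> A"
proof -
  have "emeasure (measure_of (topspace X) (borel_sets X) (upper_variation X \<mu>)) A = upper_variation X \<mu> A"
    using upper_variation_empty[OF \<mu>] countably_additive_upper_variation[OF \<mu>]
    by (intro emeasure_measure_of_sigma sigma_algebra_borel_sets A) (auto simp: positive_def)
  then show ?thesis
    unfolding pos_variation_def upper_variation_def .
qed

text \<open>Boundedness of \<open>\<mu>\<close> enters here: the supremum defining the mass of the
  whole space is at most \<open>K\<close>.\<close>

lemma finite_measure_pos_variation:
  assumes \<mu>: "\<mu> \<in> signed_measures X"
  shows "finite_measure (pos_variation X \<mu>)"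
proof
  interpret sigma_algebra "topspace X" "borel_sets X"
    by (rule sigma_algebra_borel_sets)
  obtain K where K: "\<And>A. A \<in> borel_sets X \<Longrightarrow> \<bar>\<mu> A\<bar> \<le> K"
    using signed_measure_bounded[OF \<mu>] by blast
  have "\<mu> A \<le> K" if "A \<in> borel_sets X" for A
    using K[OF that] by linarith
  then have "upper_variation X \<mu> (topspace X) \<le> ennreal K"
    by (intro upper_variation_least ennreal_leI)
  then have "upper_variation X \<mu> (topspace X) < top"
    by (rule le_less_trans) (rule ennreal_less_top)
  then show "emeasure (pos_variation X \<mu>) (space (pos_variation X \<mu>)) \<noteq> \<infinity>"
    unfolding space_pos_variation emeasure_pos_variation[OF \<mu> top]
    by simp
qed

lemma measure_pos_variation_upper:
  assumes \<mu>: "\<mu> \<in> signed_measures X" and "A \<in> borel_sets X" "B \<in> borel_sets X" "B \<subseteq> A"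
  shows "\<mu> B \<le> measure (pos_variation X \<mu>) A"
proof -
  interpret finite_measure "pos_variation X \<mu>"
    by (rule finite_measure_pos_variation[OF \<mu>])
  have "ennreal (\<mu> B) \<le> emeasure (pos_variation X \<mu>) A"
    unfolding emeasure_pos_variation[OF \<mu> assms(2)] by (rule upper_variation_upper) fact+
  also have "\<dots> = ennreal (measure (pos_variation X \<mu>) A)"
    by (rule emeasure_eq_measure)
  finally show ?thesis
    by (rule ennreal_le_iff[THEN iffD1, rotated]) (rule measure_nonneg)
qed

lemma measure_pos_variation_least:
  assumes \<mu>: "\<mu> \<in> signed_measures X" and A: "A \<in> borel_sets X"
    and le: "\<And>B. B \<in> borel_sets X \<Longrightarrow> B \<subseteq> A \<Longrightarrow> \<mu> B \<le> c"
  shows "measure (pos_variation X \<mu>) A \<le> c"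
proof -
  interpret sigma_algebra "topspace X" "borel_sets X"
    by (rule sigma_algebra_borel_sets)
  interpret finite_measure "pos_variation X \<mu>"
    by (rule finite_measure_pos_variation[OF \<mu>])
  have "0 \<le> c"
    using le[of "{}"] signed_measure_empty[OF \<mu>] by simp
  have "ennreal (measure (pos_variation X \<mu>) A) = upper_variation X \<mu> A"
    unfolding emeasure_pos_variation[OF \<mu> A, symmetric] by (rule emeasure_eq_measure[symmetric])
  also have "\<dots> \<le> ennreal c"
    by (intro upper_variation_least ennreal_leI le)
  finally show ?thesis
    by (rule ennreal_le_iff[THEN iffD1, OF \<open>0 \<le> c\<close>])
qed

text \<open>For Borel \<open>B \<subseteq> A\<close>, additivity gives
  \<open>\<mu> B = \<mu> A - \<mu> (A - B)\<close>, and \<open>- \<mu> (A - B)\<close> is at most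
  the negative part of \<open>A\<close>. The supremum over \<open>B\<close> yields one inequality,
  and the same argument for \<open>- \<mu>\<close> the other; no Hahn decomposition is
  involved.\<close>

lemma jordan_decomposition:
  assumes \<mu>: "\<mu> \<in> signed_measures X" and A: "A \<in> borel_sets X"
  shows "\<mu> A = measure (pos_variation X \<mu>) A - measure (pos_variation X (\<lambda>A. - \<mu> A)) A"
proof -
  interpret sigma_algebra "topspace X" "borel_sets X"
    by (rule sigma_algebra_borel_sets)
  note neg = signed_measures_uminus[OF \<mu>]
  let ?p = "measure (pos_variation X \<mu>) A"
  let ?n = "measure (pos_variation X (\<lambda>A. - \<mu> A)) A"
  have "?p \<le> \<mu> A + ?n"
  proof (rule measure_pos_variation_least[OF \<mu> A])
    fix B assume B: "B \<in> borel_sets X" "B \<subseteq> A"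
    show "\<mu> B \<le> \<mu> A + ?n"
      using measure_pos_variation_upper[OF neg A, of "A - B"] signed_measure_Diff[OF \<mu> A B] Diff[OF A B(1)]
      by auto
  qed
  moreover have "?n \<le> ?p - \<mu> A"
  proof (rule measure_pos_variation_least[OF neg A])
    fix B assume B: "B \<in> borel_sets X" "B \<subseteq> A"
    show "- \<mu> B \<le> ?p - \<mu> A"
      using measure_pos_variation_upper[OF \<mu> A, of "A - B"] signed_measure_Diff[OF \<mu> A B] Diff[OF A B(1)]
      by auto
  qed
  ultimately show ?thesis
    by simp
qed

subsection \<open>The dual of \<open>SC X\<close>\<close>

lemma SC_zero: "(\<lambda>_. 0) \<in> SC X"
  using real_fun_space_SC unfolding real_fun_space_def by blast

lemma SC_add: "f \<in> SC X \<Longrightarrow> g \<in> SC X \<Longrightarrow> (\<lambda>x. f x + g x) \<in> SC X"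
  using real_fun_space_SC unfolding real_fun_space_def by blast

lemma SC_cmult: "f \<in> SC X \<Longrightarrow> (\<lambda>x. c * f x) \<in> SC X"
  using real_fun_space_SC unfolding real_fun_space_def by blast

lemma SC_sum: "(\<And>i. i \<in> I \<Longrightarrow> f i \<in> SC X) \<Longrightarrow> (\<lambda>x. \<Sum>i\<in>I. f i x) \<in> SC X"
  by (induction I rule: infinite_finite_induct) (auto simp: SC_zero SC_add)

lemma SC_usc:
  assumes "usc_on X g" "bounded (g ` topspace X)" "\<And>x. x \<notin> topspace X \<Longrightarrow> g x = 0"
  shows "g \<in> SC X"
  by (rule SC_I[where g = g and h = "\<lambda>_. 0"]) (use assms in \<open>auto simp: usc_on_const bounded_iff\<close>)

lemma SC_indicator:
  assumes E: "closedin X E"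
  shows "indicat_real E \<in> SC X"
proof (rule SC_usc)
  have "{x \<in> topspace X. r \<le> indicat_real E x} = (if r \<le> 0 then topspace X else if r \<le> 1 then E else {})" for r
    using closedin_subset[OF E] by (auto simp: indicator_def split: if_splits)
  then show "usc_on X (indicat_real E)"
    using E unfolding usc_on_def by simp
  show "bounded (indicat_real E ` topspace X)"
    unfolding bounded_iff by (rule exI[of _ 1]) (auto simp: indicator_def)
  show "indicat_real E x = 0" if "x \<notin> topspace X" for x
    using that closedin_subset[OF E] by (auto simp: indicator_def)
qed

lemma sup_norm_nonneg: "f \<in> SC X \<Longrightarrow> 0 \<le> sup_norm f"
  using abs_le_sup_norm[of f X undefined] by linarith

lemma SC_dual_outside: "\<phi> \<in> SC_dual X \<Longrightarrow> f \<notin> SC X \<Longrightarrow> \<phi> f = 0"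
  unfolding SC_dual_def by blast

lemma SC_dual_add:
  "\<phi> \<in> SC_dual X \<Longrightarrow> f \<in> SC X \<Longrightarrow> g \<in> SC X \<Longrightarrow> \<phi> (\<lambda>x. f x + g x) = \<phi> f + \<phi> g"
  unfolding SC_dual_def by blast

lemma SC_dual_cmult: "\<phi> \<in> SC_dual X \<Longrightarrow> f \<in> SC X \<Longrightarrow> \<phi> (\<lambda>x. c * f x) = c * \<phi> f"
  unfolding SC_dual_def by blast

lemma SC_dual_zero: "\<phi> \<in> SC_dual X \<Longrightarrow> \<phi> (\<lambda>_. 0) = 0"
  using SC_dual_cmult[of \<phi> X "\<lambda>_. 0" 0] SC_zero[of X] by simp

lemma SC_dual_diff:
  assumes "\<phi> \<in> SC_dual X" "f \<in> SC X" "g \<in> SC X"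
  shows "\<phi> (\<lambda>x. f x - g x) = \<phi> f - \<phi> g"
  using SC_dual_add[OF assms(1) SC_diff[OF assms(2,3)] assms(3)] by simp

lemma SC_dual_sum:
  assumes "\<phi> \<in> SC_dual X" "\<And>i. i \<in> I \<Longrightarrow> f i \<in> SC X"
  shows "\<phi> (\<lambda>x. \<Sum>i\<in>I. f i x) = (\<Sum>i\<in>I. \<phi> (f i))"
  using assms(2)
proof (induction I rule: infinite_finite_induct)
  case (insert i I)
  then show ?case
    by (simp add: SC_dual_add[OF assms(1)] SC_sum)
qed (simp_all add: SC_dual_zero[OF assms(1)])

text \<open>Continuity at 0 gives a ball on which \<open>\<phi>\<close> is below 1 in absolute
  value, and scaling spreads the bound to all of \<open>SC X\<close>. The sign of \<open>C\<close>
  is left open, hence the \<open>\<bar>C\<bar>\<close> in later estimates.\<close>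

lemma SC_dual_bound:
  assumes \<phi>: "\<phi> \<in> SC_dual X"
  obtains C where "\<And>f. f \<in> SC X \<Longrightarrow> \<bar>\<phi> f\<bar> \<le> C * sup_norm f"
proof -
  interpret Metric_space "SC X" "SC_dist X"
    by (rule Metric_space_SC)
  have "continuous_map mtopology euclideanreal \<phi>"
    using \<phi> unfolding SC_dual_def SC_topology_def by blast
  then have "openin mtopology {f \<in> SC X. \<phi> f \<in> {-1<..<1}}"
    unfolding continuous_map by (auto simp del: greaterThanLessThan_iff)
  moreover have "(\<lambda>_. 0) \<in> {f \<in> SC X. \<phi> f \<in> {-1<..<1}}"
    by (simp add: SC_zero SC_dual_zero[OF \<phi>])
  ultimately obtain r where r: "r > 0" "mball (\<lambda>_. 0) r \<subseteq> {f \<in> SC X. \<phi> f \<in> {-1<..<1}}"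
    unfolding openin_mtopology by blast
  have "\<bar>\<phi> f\<bar> \<le> 2 / r * sup_norm f" if f: "f \<in> SC X" for f
  proof (cases "sup_norm f = 0")
    case True
    then have "f = (\<lambda>_. 0)"
      using abs_le_sup_norm[OF f] by (auto simp: fun_eq_iff)
    then show ?thesis
      using True SC_dual_zero[OF \<phi>] by simp
  next
    case False
    then have s: "sup_norm f > 0"
      using sup_norm_nonneg[OF f] by linarith
    \<comment> \<open>The factor 2 puts \<open>c * f\<close> at norm \<open>r / 2\<close>, strictly
      inside the ball of radius \<open>r\<close>.\<close>
    define c where "c = r / (2 * sup_norm f)"
    have c: "c > 0"
      using s r by (simp add: c_def)
    have "sup_norm (\<lambda>x. 0 - c * f x) \<le> c * sup_norm f"
      by (rule sup_norm_le) (use c abs_le_sup_norm[OF f] in \<open>auto simp: abs_mult\<close>)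
    also have "\<dots> < r"
      using s r by (simp add: c_def)
    finally have "(\<lambda>x. c * f x) \<in> mball (\<lambda>_. 0) r"
      using SC_cmult[OF f] SC_zero by (simp add: SC_dist_def)
    then have "\<phi> (\<lambda>x. c * f x) \<in> {-1<..<1}"
      using r(2) by blast
    then have "c * \<bar>\<phi> f\<bar> < 1"
      using c by (auto simp: SC_dual_cmult[OF \<phi> f] abs_if)
    then have "\<bar>\<phi> f\<bar> < 1 / c"
      using c by (simp add: field_simps)
    then show ?thesis
      by (simp add: c_def)
  qed
  then show ?thesis
    by (rule that)
qed

lemma SC_dualI:
  assumes outside: "\<And>f. f \<notin> SC X \<Longrightarrow> \<phi> f = 0"
    and add: "\<And>f g. f \<in> SC X \<Longrightarrow> g \<in> SC X \<Longrightarrow> \<phi> (\<lambda>x. f x + g x) = \<phi> f + \<phi> g"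
    and cmult: "\<And>c f. f \<in> SC X \<Longrightarrow> \<phi> (\<lambda>x. c * f x) = c * \<phi> f"
    and bound: "\<And>f. f \<in> SC X \<Longrightarrow> \<bar>\<phi> f\<bar> \<le> C * sup_norm f"
  shows "\<phi> \<in> SC_dual X"
proof -
  interpret Metric_space "SC X" "SC_dist X"
    by (rule Metric_space_SC)
  have "openin mtopology {f \<in> SC X. \<phi> f \<in> U}" if U: "open U" for U
    unfolding openin_mtopology
  proof (intro conjI allI impI)
    fix f assume f: "f \<in> {f \<in> SC X. \<phi> f \<in> U}"
    then obtain e where e: "e > 0" "\<And>y. \<bar>y - \<phi> f\<bar> < e \<Longrightarrow> y \<in> U"
      using U unfolding open_real by blast
    \<comment> \<open>Adding 1 to \<open>\<bar>C\<bar>\<close> keeps the radius positive when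
      \<open>C = 0\<close>.\<close>
    have "g \<in> {f \<in> SC X. \<phi> f \<in> U}" if "g \<in> mball f (e / (\<bar>C\<bar> + 1))" for g
    proof -
      have g: "g \<in> SC X" "sup_norm (\<lambda>x. f x - g x) < e / (\<bar>C\<bar> + 1)"
        using that by (auto simp: SC_dist_def split: if_splits)
      have fg: "(\<lambda>x. f x - g x) \<in> SC X"
        using f g by (auto intro: SC_diff)
      have "\<phi> f = \<phi> (\<lambda>x. f x - g x) + \<phi> g"
        using add[OF fg g(1)] by simp
      then have "\<bar>\<phi> g - \<phi> f\<bar> \<le> C * sup_norm (\<lambda>x. f x - g x)"
        using bound[OF fg] by linarith
      also have "\<dots> \<le> (\<bar>C\<bar> + 1) * sup_norm (\<lambda>x. f x - g x)"
        using sup_norm_nonneg[OF fg] by (intro mult_right_mono) auto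
      also have "\<dots> < e"
        using g(2) by (simp add: pos_less_divide_eq mult.commute add_nonneg_pos)
      finally show ?thesis
        using e(2) g(1) by blast
    qed
    then show "\<exists>r>0. mball f r \<subseteq> {f \<in> SC X. \<phi> f \<in> U}"
      using e(1) by (intro exI[of _ "e / (\<bar>C\<bar> + 1)"]) (auto simp: add_nonneg_pos)
  qed auto
  then have "continuous_map mtopology euclideanreal \<phi>"
    unfolding continuous_map by simp
  then show ?thesis
    using outside add cmult unfolding SC_dual_def SC_topology_def by blast
qed

lemma real_fun_space_SC_dual: "real_fun_space (SC_dual X)"
  unfolding real_fun_space_def
proof (intro conjI ballI allI)
  show "(\<lambda>_. 0) \<in> SC_dual X"
    by (rule SC_dualI[where C = 0]) auto
next
  fix \<phi> \<psi> assume *: "\<phi> \<in> SC_dual X" "\<psi> \<in> SC_dual X"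
  obtain C where C: "\<And>f. f \<in> SC X \<Longrightarrow> \<bar>\<phi> f\<bar> \<le> C * sup_norm f"
    using SC_dual_bound[OF *(1)] by blast
  obtain D where D: "\<And>f. f \<in> SC X \<Longrightarrow> \<bar>\<psi> f\<bar> \<le> D * sup_norm f"
    using SC_dual_bound[OF *(2)] by blast
  show "(\<lambda>f. \<phi> f + \<psi> f) \<in> SC_dual X"
  proof (rule SC_dualI[where C = "C + D"])
    show "\<bar>\<phi> f + \<psi> f\<bar> \<le> (C + D) * sup_norm f" if "f \<in> SC X" for f
      using C[OF that] D[OF that] unfolding distrib_right by linarith
  qed (use * in \<open>auto simp: SC_dual_outside SC_dual_add SC_dual_cmult algebra_simps\<close>)
next
  fix c \<phi> assume *: "\<phi> \<in> SC_dual X"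
  obtain C where C: "\<And>f. f \<in> SC X \<Longrightarrow> \<bar>\<phi> f\<bar> \<le> C * sup_norm f"
    using SC_dual_bound[OF *] by blast
  show "(\<lambda>f. c * \<phi> f) \<in> SC_dual X"
  proof (rule SC_dualI[where C = "\<bar>c\<bar> * C"])
    show "\<bar>c * \<phi> f\<bar> \<le> \<bar>c\<bar> * C * sup_norm f" if "f \<in> SC X" for f
      using mult_left_mono[OF C[OF that], of "\<bar>c\<bar>"] by (simp add: abs_mult mult.assoc)
  qed (use * in \<open>auto simp: SC_dual_outside SC_dual_add SC_dual_cmult algebra_simps\<close>)
qed

text \<open>The sum counts the positive integers up to \<open>t\<close>; \<open>N\<close> is large
  enough to include all of them, so it equals the floor of \<open>t\<close> and the error is the
  fractional part.\<close>

lemma staircase_approx: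
  fixes t :: real
  assumes "0 \<le> t" "t \<le> real N"
  shows "\<bar>t - (\<Sum>k=1..N. of_bool (real k \<le> t))\<bar> \<le> 1"
proof -
  define m where "m = nat \<lfloor>t\<rfloor>"
  have m: "real m \<le> t" "t < real m + 1"
    using assms unfolding m_def by linarith+
  have eq: "{k \<in> {1..N}. real k \<le> t} = {1..m}"
  proof -
    have le: "real k \<le> t \<longleftrightarrow> k \<le> m" for k
      using m by linarith
    have "m \<le> N"
      using m assms by linarith
    then show ?thesis
      unfolding le by auto
  qed
  have "(\<Sum>k=1..N. of_bool (real k \<le> t)) = (\<Sum>k\<in>{k \<in> {1..N}. real k \<le> t}. 1 :: real)"
    by (rule sum.mono_neutral_cong_right) auto
  then have "(\<Sum>k=1..N. of_bool (real k \<le> t)) = real m"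
    unfolding eq by simp
  then show ?thesis
    using m by simp
qed

text \<open>Bounded upper semicontinuous functions are uniform limits of combinations of indicators of
  their superlevel sets.\<close>

lemma SC_dual_eqI:
  assumes \<phi>: "\<phi> \<in> SC_dual X" and \<psi>: "\<psi> \<in> SC_dual X"
    and eq: "\<And>E. closedin X E \<Longrightarrow> \<phi> (indicat_real E) = \<psi> (indicat_real E)"
  shows "\<phi> = \<psi>"
proof -
  obtain C where C: "\<And>f. f \<in> SC X \<Longrightarrow> \<bar>\<phi> f\<bar> \<le> C * sup_norm f"
    using SC_dual_bound[OF \<phi>] by blast
  obtain D where D: "\<And>f. f \<in> SC X \<Longrightarrow> \<bar>\<psi> f\<bar> \<le> D * sup_norm f"
    using SC_dual_bound[OF \<psi>] by blast
  have usc: "\<phi> g = \<psi> g"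
    if g: "usc_on X g" "bounded (g ` topspace X)" "\<And>x. x \<notin> topspace X \<Longrightarrow> g x = 0" for g
  proof -
    have gSC: "g \<in> SC X"
      by (rule SC_usc) (fact g)+
    obtain M where M: "\<And>x. x \<in> topspace X \<Longrightarrow> \<bar>g x\<bar> \<le> M"
      using g(2) unfolding bounded_iff by auto
    have approx: "\<bar>\<phi> g - \<psi> g\<bar> \<le> (\<bar>C\<bar> + \<bar>D\<bar>) * e" if e: "e > 0" for e
    proof -
      \<comment> \<open>Enough steps of height \<open>e\<close> to climb from \<open>- M\<close> to
        \<open>M\<close>, between which \<open>g\<close> takes its values.\<close>
      define N where "N = nat \<lceil>2 * M / e\<rceil>"
      have N: "2 * M / e \<le> real N"
        unfolding N_def by linarith
      define L where "L k = {x \<in> topspace X. g x \<ge> real k * e - M}" for k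
      have L: "closedin X (L k)" for k
        using g(1) unfolding usc_on_def L_def by blast
      \<comment> \<open>A staircase that starts at \<open>- M\<close> and rises by \<open>e\<close>
        on each superlevel set. The offset uses the indicator of the space instead of a constant so
        that \<open>s\<close> vanishes outside it.\<close>
      define s where "s x = (\<Sum>k=1..N. e * indicat_real (L k) x) - M * indicat_real (topspace X) x" for x
      have sum: "(\<lambda>x. \<Sum>k=1..N. e * indicat_real (L k) x) \<in> SC X"
        by (intro SC_sum SC_cmult SC_indicator L)
      have top: "(\<lambda>x. M * indicat_real (topspace X) x) \<in> SC X"
        by (intro SC_cmult SC_indicator) simp
      have s: "s \<in> SC X"
        unfolding s_def by (rule SC_diff[OF sum top])
      have \<phi>s: "\<theta> s = (\<Sum>k=1..N. e * \<theta> (indicat_real (L k))) - M * \<theta> (indicat_real (topspace X))"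
        if "\<theta> \<in> SC_dual X" for \<theta>
        unfolding s_def SC_dual_diff[OF that sum top]
        by (subst SC_dual_sum[OF that]) (simp_all add: SC_dual_cmult[OF that] SC_cmult SC_indicator L)
      have "\<phi> s = \<psi> s"
        unfolding \<phi>s[OF \<phi>] \<phi>s[OF \<psi>] by (simp add: eq L)
      have le: "sup_norm (\<lambda>x. g x - s x) \<le> e"
      proof (rule sup_norm_le)
        fix x
        show "\<bar>g x - s x\<bar> \<le> e"
        proof (cases "x \<in> topspace X")
          case False
          then show ?thesis
            using g(3)[of x] e by (simp add: s_def L_def)
        next
          case True
          \<comment> \<open>Measured from \<open>- M\<close> in units of \<open>e\<close>, the
            levels become the integers \<open>1..N\<close>.\<close>
          let ?t = "(g x + M) / e"
          have "indicat_real (L k) x = of_bool (real k \<le> ?t)" for k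
            using True e by (auto simp: L_def indicator_def field_simps)
          then have "s x = e * (\<Sum>k=1..N. of_bool (real k \<le> ?t)) - M"
            using True by (simp add: s_def sum_distrib_left)
          then have "g x - s x = e * (?t - (\<Sum>k=1..N. of_bool (real k \<le> ?t)))"
            using e by (simp add: right_diff_distrib)
          moreover have "\<bar>?t - (\<Sum>k=1..N. of_bool (real k \<le> ?t))\<bar> \<le> 1"
          proof (rule staircase_approx)
            show "0 \<le> ?t"
              using M[OF True] e by simp
            have "?t \<le> 2 * M / e"
              using M[OF True] e by (intro divide_right_mono) auto
            then show "?t \<le> real N"
              using N by linarith
          qed
          ultimately show ?thesis
            using e by (simp add: abs_mult)
        qed
      qed
      have gs: "(\<lambda>x. g x - s x) \<in> SC X"
        by (rule SC_diff[OF gSC s])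
      have "C * sup_norm (\<lambda>x. g x - s x) \<le> \<bar>C\<bar> * e"
        by (rule mult_mono) (use le sup_norm_nonneg[OF gs] in auto)
      then have 1: "\<bar>\<phi> g - \<phi> s\<bar> \<le> \<bar>C\<bar> * e"
        using C[OF gs] unfolding SC_dual_diff[OF \<phi> gSC s] by linarith
      have "D * sup_norm (\<lambda>x. g x - s x) \<le> \<bar>D\<bar> * e"
        by (rule mult_mono) (use le sup_norm_nonneg[OF gs] in auto)
      then have 2: "\<bar>\<psi> g - \<psi> s\<bar> \<le> \<bar>D\<bar> * e"
        using D[OF gs] unfolding SC_dual_diff[OF \<psi> gSC s] by linarith
      show ?thesis
        using 1 2 \<open>\<phi> s = \<psi> s\<close> unfolding distrib_right by linarith
    qed
    \<comment> \<open>The constant factor is absorbed by rescaling \<open>e\<close>; the added 1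
      avoids a zero denominator. The summand 0 gives the shape that \<open>field_le_epsilon\<close>
      expects.\<close>
    have "\<bar>\<phi> g - \<psi> g\<bar> \<le> 0 + e" if e: "e > 0" for e
    proof -
      have "\<bar>\<phi> g - \<psi> g\<bar> \<le> (\<bar>C\<bar> + \<bar>D\<bar>) * (e / (\<bar>C\<bar> + \<bar>D\<bar> + 1))"
        by (rule approx) (use e in \<open>auto intro!: divide_pos_pos\<close>)
      also have "\<dots> \<le> (\<bar>C\<bar> + \<bar>D\<bar> + 1) * (e / (\<bar>C\<bar> + \<bar>D\<bar> + 1))"
        by (rule mult_right_mono) (use e in auto)
      also have "\<dots> = e"
        using abs_ge_zero[of C] abs_ge_zero[of D] by (simp add: field_simps)
      finally show ?thesis
        by simp
    qed
    then have "\<bar>\<phi> g - \<psi> g\<bar> \<le> 0"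
      by (rule field_le_epsilon)
    then show ?thesis
      by simp
  qed
  show ?thesis
  proof
    fix f
    show "\<phi> f = \<psi> f"
    proof (cases "f \<in> SC X")
      case False
      then show ?thesis
        using SC_dual_outside[OF \<phi>] SC_dual_outside[OF \<psi>] by simp
    next
      case True
      then obtain g h where gh: "usc_on X g" "bounded (g ` topspace X)" "usc_on X h" "bounded (h ` topspace X)"
        "\<And>x. x \<in> topspace X \<Longrightarrow> f x = g x - h x" "\<And>x. x \<notin> topspace X \<Longrightarrow> f x = 0"
        by (rule SC_E) blast
      \<comment> \<open>\<open>g\<close> and \<open>h\<close> are arbitrary outside the space,
        whereas elements of \<open>SC X\<close> vanish there; \<open>ext\<close> cuts them off
        without changing superlevel sets.\<close>
      define ext where "ext u x = (if x \<in> topspace X then u x else 0)" for u :: "'a \<Rightarrow> real" and x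
      have ext: "usc_on X (ext u)" "bounded (ext u ` topspace X)" "\<And>x. x \<notin> topspace X \<Longrightarrow> ext u x = 0"
        if "usc_on X u" "bounded (u ` topspace X)" for u
      proof -
        have "{x \<in> topspace X. r \<le> ext u x} = {x \<in> topspace X. r \<le> u x}" for r
          by (auto simp: ext_def)
        then show "usc_on X (ext u)"
          using that(1) unfolding usc_on_def by simp
        have "ext u ` topspace X = u ` topspace X"
          by (rule image_cong) (auto simp: ext_def)
        then show "bounded (ext u ` topspace X)"
          using that(2) by simp
      qed (simp add: ext_def)
      have "f = (\<lambda>x. ext g x - ext h x)"
        using gh(5,6) by (auto simp: ext_def fun_eq_iff)
      moreover have "ext g \<in> SC X" "ext h \<in> SC X"
        using gh by (auto intro: SC_usc ext)
      ultimately show ?thesis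
        using usc[OF ext[OF gh(1,2)]] usc[OF ext[OF gh(3,4)]]
        by (simp add: SC_dual_diff[OF \<phi>] SC_dual_diff[OF \<psi>])
    qed
  qed
qed

subsection \<open>The map \<open>\<Lambda>\<close>\<close>

text \<open>Superlevel sets of upper semicontinuous functions are closed, hence Borel; a bounded
  measurable function is integrable for the finite measure
  \<open>pos_variation X \<mu>\<close>.\<close>

lemma integrable_SC:
  assumes f: "f \<in> SC X" and \<mu>: "\<mu> \<in> signed_measures X"
  shows "integrable (pos_variation X \<mu>) f"
proof -
  interpret finite_measure "pos_variation X \<mu>"
    by (rule finite_measure_pos_variation[OF \<mu>])
  have usc: "u \<in> borel_measurable (pos_variation X \<mu>)" if "usc_on X u" for u
    using that unfolding borel_measurable_iff_ge usc_on_def by (auto intro: borel_sets_closedin)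
  obtain g h where gh: "usc_on X g" "usc_on X h" "\<And>x. x \<in> topspace X \<Longrightarrow> f x = g x - h x"
    using f by (rule SC_E) blast
  have "(\<lambda>x. g x - h x) \<in> borel_measurable (pos_variation X \<mu>)"
    using gh usc by measurable
  then have "f \<in> borel_measurable (pos_variation X \<mu>)"
    using gh(3) by (subst measurable_cong) auto
  then show ?thesis
    by (rule integrable_const_bound[rotated, where B = "sup_norm f"]) (simp add: abs_le_sup_norm[OF f])
qed

lemma Lambda_in_SC_dual:
  assumes \<mu>: "\<mu> \<in> signed_measures X"
  shows "Lambda X \<mu> \<in> SC_dual X"
proof -
  let ?P = "pos_variation X \<mu>" and ?N = "pos_variation X (\<lambda>A. - \<mu> A)"
  note neg = signed_measures_uminus[OF \<mu>]
  note int = integrable_SC[OF _ \<mu>] integrable_SC[OF _ neg]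
  have bound: "\<bar>\<integral>x. f x \<partial>pos_variation X \<nu>\<bar> \<le> measure (pos_variation X \<nu>) (topspace X) * sup_norm f"
    if f: "f \<in> SC X" and \<nu>: "\<nu> \<in> signed_measures X" for f \<nu>
  proof -
    interpret finite_measure "pos_variation X \<nu>"
      by (rule finite_measure_pos_variation[OF \<nu>])
    have "\<bar>\<integral>x. f x \<partial>pos_variation X \<nu>\<bar> \<le> (\<integral>x. \<bar>f x\<bar> \<partial>pos_variation X \<nu>)"
      by (rule integral_abs_bound)
    also have "\<dots> \<le> (\<integral>x. sup_norm f \<partial>pos_variation X \<nu>)"
      using integrable_SC[OF f \<nu>] by (intro integral_mono) (auto intro: abs_le_sup_norm[OF f])
    finally show ?thesis
      by simp
  qed
  show ?thesis
  proof (rule SC_dualI[where C = "measure ?P (topspace X) + measure ?N (topspace X)"])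
    show "\<bar>Lambda X \<mu> f\<bar> \<le> (measure ?P (topspace X) + measure ?N (topspace X)) * sup_norm f"
      if f: "f \<in> SC X" for f
      using bound[OF f \<mu>] bound[OF f neg] f
      unfolding Lambda_def signed_integral_def distrib_right by simp
  qed (simp_all add: Lambda_def signed_integral_def SC_add SC_cmult int algebra_simps)
qed

lemma Lambda_indicator:
  assumes \<mu>: "\<mu> \<in> signed_measures X" and E: "closedin X E"
  shows "Lambda X \<mu> (indicat_real E) = \<mu> E"
proof -
  have "E \<inter> topspace X = E"
    using closedin_subset[OF E] by auto
  then show ?thesis
    using SC_indicator[OF E] jordan_decomposition[OF \<mu> borel_sets_closedin[OF E]]
    by (simp add: Lambda_def signed_integral_def)
qed

lemma signed_measures_eqI:
  assumes \<mu>: "\<mu> \<in> signed_measures X" and \<nu>: "\<nu> \<in> signed_measures X"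
    and eq: "\<And>E. closedin X E \<Longrightarrow> \<mu> E = \<nu> E"
  shows "\<mu> = \<nu>"
proof
  fix A
  show "\<mu> A = \<nu> A"
  proof (cases "A \<in> borel_sets X")
    case False
    then show ?thesis
      using \<mu> \<nu> unfolding signed_measures_def by auto
  next
    case True
    interpret sigma_algebra "topspace X" "borel_sets X"
      by (rule sigma_algebra_borel_sets)
    have top: "topspace X \<in> borel_sets X"
      by (rule borel_sets_closedin) simp
    \<comment> \<open>The space itself is closed, so both measures have the same total mass. This
      carries equality from closed to open sets and also serves the complement step of the
      induction.\<close>
    have compl_eq: "\<mu> (topspace X - B) = \<nu> (topspace X - B)"
      if B: "B \<in> borel_sets X" "B \<subseteq> topspace X" "\<mu> B = \<nu> B" for B
      using signed_measure_Diff[OF \<mu> top B(1,2)] signed_measure_Diff[OF \<nu> top B(1,2)] B(3) eq[of "topspace X"]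
      by simp
    have "Int_stable {U. openin X U}" "{U. openin X U} \<subseteq> Pow (topspace X)"
      by (auto simp: Int_stable_def dest: openin_subset)
    moreover have "A \<in> sigma_sets (topspace X) {U. openin X U}"
      using True unfolding borel_sets_def .
    ultimately show ?thesis
    proof (induction rule: sigma_sets_induct_disjoint)
      case (basic U)
      then have "closedin X (topspace X - U)" "topspace X - (topspace X - U) = U"
        by (auto dest: openin_subset)
      then show ?case
        using compl_eq[of "topspace X - U"] eq[of "topspace X - U"] borel_sets_closedin by auto
    next
      case empty
      then show ?case
        by (simp add: signed_measure_empty[OF \<mu>] signed_measure_empty[OF \<nu>])
    next
      case (compl A)
      then show ?case
        using compl_eq sets_into_space unfolding borel_sets_def by blast
    next
      case (union A)
      then have A: "range A \<subseteq> borel_sets X"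
        unfolding borel_sets_def by simp
      have "(\<lambda>n. \<mu> (A n)) sums \<mu> (\<Union>n. A n)" "(\<lambda>n. \<nu> (A n)) sums \<nu> (\<Union>n. A n)"
        using signed_measure_sums[OF \<mu> A] signed_measure_sums[OF \<nu> A] union by auto
      then show ?case
        using union by (simp add: sums_unique2)
    qed
  qed
qed

lemma inj_on_Lambda: "inj_on (Lambda X) (signed_measures X)"
proof (rule inj_onI)
  fix \<mu> \<nu> assume *: "\<mu> \<in> signed_measures X" "\<nu> \<in> signed_measures X" "Lambda X \<mu> = Lambda X \<nu>"
  show "\<mu> = \<nu>"
  proof (rule signed_measures_eqI[OF *(1,2)])
    fix E assume "closedin X E"
    then show "\<mu> E = \<nu> E"
      using Lambda_indicator[OF *(1)] Lambda_indicator[OF *(2)] *(3) by metis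
  qed
qed

text \<open>The Jordan parts are not additive in \<open>\<mu>\<close>, so the integrals cannot be
  added directly. Instead, both sides are bounded functionals, and they agree on indicators of
  closed sets.\<close>

lemma Lambda_add:
  assumes \<mu>: "\<mu> \<in> signed_measures X" and \<nu>: "\<nu> \<in> signed_measures X"
  shows "Lambda X (\<lambda>A. \<mu> A + \<nu> A) = (\<lambda>f. Lambda X \<mu> f + Lambda X \<nu> f)"
proof (rule SC_dual_eqI)
  note sum = signed_measures_add[OF \<mu> \<nu>]
  show "Lambda X (\<lambda>A. \<mu> A + \<nu> A) \<in> SC_dual X"
    by (rule Lambda_in_SC_dual[OF sum])
  show "(\<lambda>f. Lambda X \<mu> f + Lambda X \<nu> f) \<in> SC_dual X"
    using real_fun_space_SC_dual[of X] Lambda_in_SC_dual[OF \<mu>] Lambda_in_SC_dual[OF \<nu>]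
    unfolding real_fun_space_def by blast
  show "Lambda X (\<lambda>A. \<mu> A + \<nu> A) (indicat_real E) =
      Lambda X \<mu> (indicat_real E) + Lambda X \<nu> (indicat_real E)" if "closedin X E" for E
    by (simp only: Lambda_indicator[OF sum that] Lambda_indicator[OF \<mu> that] Lambda_indicator[OF \<nu> that])
qed

lemma Lambda_cmult:
  assumes \<mu>: "\<mu> \<in> signed_measures X"
  shows "Lambda X (\<lambda>A. c * \<mu> A) = (\<lambda>f. c * Lambda X \<mu> f)"
proof (rule SC_dual_eqI)
  note c\<mu> = signed_measures_cmult[OF \<mu>]
  show "Lambda X (\<lambda>A. c * \<mu> A) \<in> SC_dual X"
    by (rule Lambda_in_SC_dual[OF c\<mu>])
  show "(\<lambda>f. c * Lambda X \<mu> f) \<in> SC_dual X"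
    using real_fun_space_SC_dual[of X] Lambda_in_SC_dual[OF \<mu>] unfolding real_fun_space_def by blast
  show "Lambda X (\<lambda>A. c * \<mu> A) (indicat_real E) = c * Lambda X \<mu> (indicat_real E)"
    if "closedin X E" for E
    by (simp only: Lambda_indicator[OF c\<mu> that] Lambda_indicator[OF \<mu> that])
qed

lemma real_fun_space_signed_measures: "real_fun_space (signed_measures X)"
  unfolding real_fun_space_def
proof (intro conjI ballI allI)
  show "(\<lambda>_. 0) \<in> signed_measures X"
    by (simp add: signed_measures_def)
qed (fact signed_measures_add signed_measures_cmult)+

subsection \<open>Zariski spaces\<close>

text \<open>Turns the descending chain condition into Noetherian induction on closed sets: an
  infinite descent would be a chain that never stabilizes.\<close>

lemma wf_closedin_noetherian:
  assumes "noetherian_space X"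
  shows "wf {(A, B). closedin X A \<and> closedin X B \<and> A \<subset> B}"
  unfolding wf_iff_no_infinite_down_chain
proof
  assume "\<exists>F. \<forall>i. (F (Suc i), F i) \<in> {(A, B). closedin X A \<and> closedin X B \<and> A \<subset> B}"
  then obtain F where "\<forall>i. (F (Suc i), F i) \<in> {(A, B). closedin X A \<and> closedin X B \<and> A \<subset> B}" ..
  then have F: "closedin X (F i)" "F (Suc i) \<subset> F i" for i
    by auto
  have "decseq F"
    by (rule decseq_SucI) (use F(2) in blast)
  then obtain N where "\<forall>n\<ge>N. F n = F N"
    using assms F(1) unfolding noetherian_space_def by blast
  then have "F (Suc N) = F N"
    using le_Suc_eq by blast
  then show False
    using F(2)[of N] by blast
qed

lemma mem_closure_of_point: "x \<in> topspace X \<Longrightarrow> x \<in> X closure_of {x}"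
  by (simp add: in_closure_of)

text \<open>If two closed sets cover the closure, the one containing \<open>x\<close> contains the
  whole closure.\<close>

lemma irreducible_closure_of_point: "irreducible_closedin X (X closure_of {x})"
  unfolding irreducible_closedin_def
proof (intro conjI notI)
  assume "\<exists>A B. closedin X A \<and> closedin X B \<and> A \<subset> X closure_of {x} \<and>
      B \<subset> X closure_of {x} \<and> X closure_of {x} = A \<union> B"
  then obtain A B where AB: "closedin X A" "closedin X B" "A \<subset> X closure_of {x}"
      "B \<subset> X closure_of {x}" "X closure_of {x} = A \<union> B"
    by iprover
  show False
  proof (cases "x \<in> topspace X")
    case True
    then have "x \<in> A \<or> x \<in> B"
      using mem_closure_of_point[OF True] unfolding AB(5) by simp
    then have "X closure_of {x} \<subseteq> A \<or> X closure_of {x} \<subseteq> B"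
      using closure_of_minimal[of "{x}" A X] closure_of_minimal[of "{x}" B X] AB(1,2) by blast
    then show False
      using AB(3,4) by blast
  next
    case False
    then have "X closure_of {x} = {}"
      by (auto simp: closure_of_def)
    then show False
      using AB(3) by blast
  qed
qed simp

text \<open>The T0 property: both points are generic in the same irreducible closed set, and generic
  points are unique.\<close>

lemma zariski_space_point_eqI:
  assumes X: "zariski_space X" and x: "x \<in> topspace X" and y: "y \<in> topspace X"
    and eq: "X closure_of {x} = X closure_of {y}"
  shows "x = y"
proof -
  have "\<exists>!z. z \<in> X closure_of {x} \<and> X closure_of {z} = X closure_of {x}"
    using X irreducible_closure_of_point[of X x] mem_closure_of_point[OF x]
    unfolding zariski_space_def by blast
  then show ?thesis
    using mem_closure_of_point[OF x] mem_closure_of_point[OF y] eq by metis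
qed

text \<open>The upper limit of a bounded net is a cluster point.\<close>

lemma directed_cluster_point:
  fixes d :: "'b set \<Rightarrow> real"
  assumes ne: "\<F> \<noteq> {}" and directed: "\<And>F G. F \<in> \<F> \<Longrightarrow> G \<in> \<F> \<Longrightarrow> F \<union> G \<in> \<F>"
    and bound: "\<And>F. F \<in> \<F> \<Longrightarrow> \<bar>d F\<bar> \<le> K"
  shows "\<exists>c. \<forall>e>0. \<forall>F\<in>\<F>. \<exists>G\<in>\<F>. F \<subseteq> G \<and> \<bar>d G - c\<bar> < e"
proof -
  define s where "s F = (SUP G\<in>{G \<in> \<F>. F \<subseteq> G}. d G)" for F
  have bdd: "bdd_above (d ` {G \<in> \<F>. F \<subseteq> G})" for F
    using bound by (intro bdd_aboveI2[where M = K]) (auto dest: abs_le_D1)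
  have s_upper: "d G \<le> s F" if "G \<in> \<F>" "F \<subseteq> G" for F G
    unfolding s_def by (rule cSUP_upper[OF _ bdd]) (use that in auto)
  have "bdd_below (s ` \<F>)"
  proof (rule bdd_belowI2[where m = "- K"])
    fix F assume "F \<in> \<F>"
    then show "- K \<le> s F"
      using s_upper[of F F] bound[of F] by auto
  qed
  then have c_lower: "(INF F\<in>\<F>. s F) \<le> s F" if "F \<in> \<F>" for F
    using that by (rule cINF_lower)
  have "\<exists>G\<in>\<F>. F \<subseteq> G \<and> \<bar>d G - (INF F\<in>\<F>. s F)\<bar> < e" if e: "e > 0" and F: "F \<in> \<F>" for e F
  proof -
    \<comment> \<open>\<open>s H\<close> exceeds the infimum of the suprema by less than
      \<open>e\<close>. Some \<open>G\<close> above \<open>F \<union> H\<close> has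
      \<open>d G\<close> within \<open>e\<close> of that infimum from below, and \<open>d G\<close>
      cannot exceed \<open>s H\<close>, which pins it from both sides.\<close>
    obtain H where H: "H \<in> \<F>" "s H < (INF F\<in>\<F>. s F) + e"
      using cINF_less_iff[OF ne \<open>bdd_below (s ` \<F>)\<close>, of "(INF F\<in>\<F>. s F) + e"] e by auto
    have FH: "F \<union> H \<in> \<F>"
      by (rule directed[OF F H(1)])
    then have "(INF F\<in>\<F>. s F) - e < s (F \<union> H)"
      using c_lower[OF FH] e by linarith
    then obtain G where G: "G \<in> \<F>" "F \<union> H \<subseteq> G" "(INF F\<in>\<F>. s F) - e < d G"
      unfolding s_def[of "F \<union> H"] using less_cSUP_iff[OF _ bdd] FH by blast
    moreover have "d G \<le> s H"
      by (rule s_upper) (use G in auto)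
    ultimately show ?thesis
      using H by (intro bexI[of _ G]) auto
  qed
  then show ?thesis
    by blast
qed

section \<open>Point masses of a functional\<close>

text \<open>For \<open>x\<close> in the space these are exactly the proper closed subsets of its
  closure, since a closed set containing \<open>x\<close> contains the closure; they are directed
  under union.\<close>

definition proper_closed :: "'a topology \<Rightarrow> 'a \<Rightarrow> 'a set set" where
  "proper_closed X x = {F. closedin X F \<and> F \<subseteq> X closure_of {x} \<and> x \<notin> F}"

lemma proper_closed_Union:
  "finite \<A> \<Longrightarrow> \<A> \<subseteq> proper_closed X x \<Longrightarrow> \<Union>\<A> \<in> proper_closed X x"
  unfolding proper_closed_def by (auto intro!: closedin_Union)

text \<open>\<open>c x\<close> is the mass that \<open>\<phi>\<close> puts at the generic point of \<open>X closure_of {x}\<close>.\<close>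

definition is_point_mass :: "'a topology \<Rightarrow> (('a \<Rightarrow> real) \<Rightarrow> real) \<Rightarrow> ('a \<Rightarrow> real) \<Rightarrow> bool" where
  "is_point_mass X \<phi> c \<longleftrightarrow> (\<forall>x\<in>topspace X. \<forall>e>0. \<forall>F\<in>proper_closed X x. \<exists>G\<in>proper_closed X x. F \<subseteq> G \<and>
     \<bar>\<phi> (indicat_real (X closure_of {x})) - \<phi> (indicat_real G) - c x\<bar> < e)"

lemma is_point_massE:
  assumes "is_point_mass X \<phi> c" "x \<in> topspace X" "e > 0" "F \<in> proper_closed X x"
  obtains G where "G \<in> proper_closed X x" "F \<subseteq> G"
    "\<bar>\<phi> (indicat_real (X closure_of {x})) - \<phi> (indicat_real G) - c x\<bar> < e"
  using assms unfolding is_point_mass_def by blast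

text \<open>Indicators of closed sets have norm at most 1, so the differences are bounded by
  \<open>2 * \<bar>C\<bar>\<close> and the net has a cluster value at each \<open>x\<close>;
  \<open>c\<close> chooses one.\<close>

lemma ex_point_mass:
  assumes \<phi>: "\<phi> \<in> SC_dual X"
  obtains c where "is_point_mass X \<phi> c"
proof -
  obtain C where C: "\<And>f. f \<in> SC X \<Longrightarrow> \<bar>\<phi> f\<bar> \<le> C * sup_norm f"
    using SC_dual_bound[OF \<phi>] by blast
  have bound: "\<bar>\<phi> (indicat_real E)\<bar> \<le> \<bar>C\<bar>" if E: "closedin X E" for E
  proof -
    have "sup_norm (indicat_real E) \<le> 1"
      by (rule sup_norm_le) (auto simp: indicator_def)
    then have "C * sup_norm (indicat_real E) \<le> \<bar>C\<bar> * 1"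
      using sup_norm_nonneg[OF SC_indicator[OF E]] by (intro mult_mono) auto
    then show ?thesis
      using C[OF SC_indicator[OF E]] by linarith
  qed
  have "\<exists>c. \<forall>e>0. \<forall>F\<in>proper_closed X x. \<exists>G\<in>proper_closed X x. F \<subseteq> G \<and>
     \<bar>\<phi> (indicat_real (X closure_of {x})) - \<phi> (indicat_real G) - c\<bar> < e" for x
  proof -
    let ?d = "\<lambda>G. \<phi> (indicat_real (X closure_of {x})) - \<phi> (indicat_real G)"
    have ne: "proper_closed X x \<noteq> {}"
      using closedin_empty[of X] by (auto simp add: proper_closed_def)
    have dir: "F \<union> G \<in> proper_closed X x" if "F \<in> proper_closed X x" "G \<in> proper_closed X x" for F G
      using proper_closed_Union[of "{F, G}"] that by simp
    have bd: "\<bar>?d F\<bar> \<le> 2 * \<bar>C\<bar>" if "F \<in> proper_closed X x" for F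
    proof -
      have "closedin X F"
        using that by (simp add: proper_closed_def)
      then show ?thesis
        using bound[of F] bound[OF closedin_closure_of, of "{x}"] by linarith
    qed
    show ?thesis
      by (rule directed_cluster_point[OF ne dir bd])
  qed
  then have "\<exists>c. is_point_mass X \<phi> c"
    unfolding is_point_mass_def by metis
  then show ?thesis
    using that by blast
qed

text \<open>For finitely many points, the sets \<open>X closure_of {x} - G x\<close> can be made disjoint, so that
  testing \<open>\<phi>\<close> on a signed combination of their indicators bounds the total mass.\<close>

lemma sum_point_mass_le:
  assumes X: "zariski_space X" and \<phi>: "\<phi> \<in> SC_dual X" and c: "is_point_mass X \<phi> c"
    and C: "\<And>f. f \<in> SC X \<Longrightarrow> \<bar>\<phi> f\<bar> \<le> C * sup_norm f"
    and S: "finite S" "S \<subseteq> topspace X"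
  shows "(\<Sum>x\<in>S. \<bar>c x\<bar>) \<le> \<bar>C\<bar>"
proof -
  let ?cl = "\<lambda>x. X closure_of {x}"
  have "(\<Sum>x\<in>S. \<bar>c x\<bar>) \<le> \<bar>C\<bar> + d" if d: "d > 0" for d
  proof -
    \<comment> \<open>Leaves a total error of at most \<open>d\<close> over the points of
      \<open>S\<close>, also for empty \<open>S\<close>.\<close>
    define e where "e = d / (real (card S) + 1)"
    have e: "e > 0"
      using d by (simp add: e_def)
    \<comment> \<open>The part of the closure of \<open>x\<close> shared with closures of points of
      \<open>S\<close> that miss \<open>x\<close>; every \<open>G x\<close> above it removes this
      overlap.\<close>
    define F where "F x = \<Union>((\<lambda>y. ?cl x \<inter> ?cl y) ` {y \<in> S. x \<notin> ?cl y})" for x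
    have F: "F x \<in> proper_closed X x" for x
      unfolding F_def by (rule proper_closed_Union) (use S in \<open>auto simp: proper_closed_def\<close>)
    have "\<exists>G. G \<in> proper_closed X x \<and> F x \<subseteq> G \<and> \<bar>\<phi> (indicat_real (?cl x)) - \<phi> (indicat_real G) - c x\<bar> < e"
      if "x \<in> S" for x
      using is_point_massE[OF c _ e F[of x]] S that by blast
    then obtain G where G: "\<And>x. x \<in> S \<Longrightarrow> G x \<in> proper_closed X x" "\<And>x. x \<in> S \<Longrightarrow> F x \<subseteq> G x"
      "\<And>x. x \<in> S \<Longrightarrow> \<bar>\<phi> (indicat_real (?cl x)) - \<phi> (indicat_real (G x)) - c x\<bar> < e"
      by metis
    \<comment> \<open>A point common to both differences lies in both closures; if \<open>x\<close>
      were not in the closure of \<open>y\<close>, that point would belong to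
      \<open>F x \<subseteq> G x\<close>. So each of \<open>x\<close> and \<open>y\<close> lies in
      the closure of the other, and T0 applies.\<close>
    have disj: "x = y" if "x \<in> S" "y \<in> S" "z \<in> ?cl x - G x" "z \<in> ?cl y - G y" for x y z
    proof -
      have "x \<in> ?cl y"
        using that G(2)[of x] by (auto simp: F_def)
      moreover have "y \<in> ?cl x"
        using that G(2)[of y] by (auto simp: F_def)
      ultimately have "?cl x = ?cl y"
        by (intro antisym closure_of_minimal) auto
      then show ?thesis
        using zariski_space_point_eqI[OF X] S that by blast
    qed
    \<comment> \<open>The sign makes \<open>\<phi> (h x)\<close> at least
      \<open>\<bar>c x\<bar> - e\<close>, while disjoint supports keep the sum of the
      \<open>h x\<close> within norm 1.\<close>
    define h where "h x = (\<lambda>z. sgn (c x) * (indicat_real (?cl x) z - indicat_real (G x) z))" for x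
    have hd: "(\<lambda>z. indicat_real (?cl x) z - indicat_real (G x) z) \<in> SC X"
      and \<phi>d: "\<phi> (\<lambda>z. indicat_real (?cl x) z - indicat_real (G x) z) = \<phi> (indicat_real (?cl x)) - \<phi> (indicat_real (G x))"
      if "x \<in> S" for x
      using G(1)[OF that] by (auto intro!: SC_diff SC_indicator SC_dual_diff[OF \<phi>] simp: proper_closed_def)
    have h: "h x \<in> SC X" if "x \<in> S" for x
      unfolding h_def by (rule SC_cmult[OF hd[OF that]])
    have \<phi>h: "\<bar>c x\<bar> - e \<le> \<phi> (h x)" if "x \<in> S" for x
    proof -
      have "\<phi> (h x) = sgn (c x) * (\<phi> (indicat_real (?cl x)) - \<phi> (indicat_real (G x)))"
        unfolding h_def by (simp add: SC_dual_cmult[OF \<phi> hd[OF that]] \<phi>d[OF that])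
      then show ?thesis
        using G(3)[OF that] e by (cases "c x" "0::real" rule: linorder_cases) (auto simp: abs_less_iff)
    qed
    have h_eq: "h x z = (if z \<in> ?cl x - G x then sgn (c x) else 0)" if "x \<in> S" for x z
      using G(1)[OF that] by (auto simp: h_def proper_closed_def indicator_def)
    have hsum: "(\<lambda>z. \<Sum>x\<in>S. h x z) \<in> SC X"
      using h by (rule SC_sum)
    have "\<bar>\<Sum>x\<in>S. h x z\<bar> \<le> 1" for z
    proof (cases "\<exists>x\<in>S. z \<in> ?cl x - G x")
      case True
      then obtain x where x: "x \<in> S" "z \<in> ?cl x - G x"
        by blast
      have zero: "h y z = 0" if "y \<in> S" "y \<noteq> x" for y
      proof -
        have "z \<notin> ?cl y - G y"
          using disj[OF that(1) x(1) _ x(2)] that(2) by blast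
        then show ?thesis
          unfolding h_eq[OF that(1)] by (rule if_not_P)
      qed
      have "(\<Sum>y\<in>S. h y z) = (\<Sum>y\<in>{x}. h y z)"
        by (rule sum.mono_neutral_right) (use S x(1) zero in auto)
      then show ?thesis
        using x by (simp add: h_eq sgn_if)
    next
      case False
      then have "(\<Sum>y\<in>S. h y z) = 0"
        by (intro sum.neutral) (auto simp: h_eq)
      then show ?thesis
        by simp
    qed
    then have "sup_norm (\<lambda>z. \<Sum>x\<in>S. h x z) \<le> 1"
      by (rule sup_norm_le)
    then have "C * sup_norm (\<lambda>z. \<Sum>x\<in>S. h x z) \<le> \<bar>C\<bar> * 1"
      using sup_norm_nonneg[OF hsum] by (intro mult_mono) auto
    moreover have "(\<Sum>x\<in>S. \<phi> (h x)) \<le> C * sup_norm (\<lambda>z. \<Sum>x\<in>S. h x z)"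
      using C[OF hsum] SC_dual_sum[OF \<phi> h, of S "\<lambda>x. x"] by simp
    moreover have "(\<Sum>x\<in>S. \<bar>c x\<bar> - e) \<le> (\<Sum>x\<in>S. \<phi> (h x))"
      by (rule sum_mono) (rule \<phi>h)
    moreover have "real (card S) * e \<le> d"
      using d by (simp add: e_def field_simps)
    ultimately show ?thesis
      by (simp add: sum_subtractf)
  qed
  then show ?thesis
    by (rule field_le_epsilon)
qed

lemma point_mass_abs_summable:
  assumes X: "zariski_space X" and \<phi>: "\<phi> \<in> SC_dual X" and c: "is_point_mass X \<phi> c"
  shows "(\<lambda>x. \<bar>c x\<bar>) summable_on topspace X"
proof -
  obtain C where C: "\<And>f. f \<in> SC X \<Longrightarrow> \<bar>\<phi> f\<bar> \<le> C * sup_norm f"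
    using SC_dual_bound[OF \<phi>] by blast
  show ?thesis
    by (rule nonneg_bdd_above_summable_on)
      (auto intro!: bdd_aboveI2[where M = "\<bar>C\<bar>"] sum_point_mass_le[OF X \<phi> c C])
qed

lemma point_mass_summable:
  assumes "zariski_space X" "\<phi> \<in> SC_dual X" "is_point_mass X \<phi> c"
  shows "c summable_on topspace X"
  by (rule abs_summable_summable) (use point_mass_abs_summable[OF assms] in simp)

lemma infsum_point_mass:
  assumes X: "zariski_space X" and \<phi>: "\<phi> \<in> SC_dual X" and c: "is_point_mass X \<phi> c"
    and E: "closedin X E"
  shows "\<phi> (indicat_real E) = infsum c E"
proof -
  note abs_summable = point_mass_abs_summable[OF X \<phi> c]
  have abs_summable_sub: "(\<lambda>x. \<bar>c x\<bar>) summable_on A" if "A \<subseteq> topspace X" for A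
    using summable_on_subset_banach[OF abs_summable that] .
  have summable_sub: "c summable_on A" if "A \<subseteq> topspace X" for A
    using summable_on_subset_banach[OF point_mass_summable[OF X \<phi> c] that] .
  have "wf {(A, B). closedin X A \<and> closedin X B \<and> A \<subset> B}"
    using X wf_closedin_noetherian unfolding zariski_space_def by blast
  then show ?thesis
    using E
  proof (induction E rule: wf_induct_rule)
    case (less E)
    have IH: "\<phi> (indicat_real F) = infsum c F" if "closedin X F" "F \<subset> E" for F
      using less that by blast
    have sub: "E \<subseteq> topspace X"
      using less.prems by (rule closedin_subset)
    show ?case
    proof (cases "irreducible_closedin X E")
      case False
      then obtain A B where AB: "closedin X A" "closedin X B" "A \<subset> E" "B \<subset> E" "E = A \<union> B"
        using less.prems unfolding irreducible_closedin_def by blast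
      \<comment> \<open>Inclusion-exclusion: \<open>A\<close>, \<open>B\<close> and
        \<open>A \<inter> B\<close> are all properly contained in \<open>E\<close>, so the induction
        hypothesis covers the three other terms.\<close>
      have "(\<lambda>x. indicat_real E x + indicat_real (A \<inter> B) x) = (\<lambda>x. indicat_real A x + indicat_real B x)"
        using AB(5) by (auto simp: indicator_def fun_eq_iff)
      then have "\<phi> (indicat_real E) + \<phi> (indicat_real (A \<inter> B)) = \<phi> (indicat_real A) + \<phi> (indicat_real B)"
        using AB(1,2) less.prems
        by (simp add: SC_dual_add[OF \<phi>, symmetric] SC_indicator closedin_Int)
      moreover have "A \<inter> B \<subset> E"
        using AB(3) by blast
      ultimately have "\<phi> (indicat_real E) = infsum c A + infsum c B - infsum c (A \<inter> B)"
        using IH[of A] IH[of B] IH[of "A \<inter> B"] AB by (auto simp: closedin_Int)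
      also have "\<dots> = infsum c (A \<union> B)"
        using AB sub by (intro infsum_Un_Int[symmetric] summable_sub) auto
      finally show ?thesis
        using AB(5) by simp
    next
      case True
      show ?thesis
      proof (cases "E = {}")
        case True
        then show ?thesis
          using SC_dual_zero[OF \<phi>] by simp
      next
        case False
        then have ex1: "\<exists>!x. x \<in> E \<and> X closure_of {x} = E"
          using X True unfolding zariski_space_def by blast
        then obtain x where x: "x \<in> E" "X closure_of {x} = E"
          by blast
        have "\<bar>\<phi> (indicat_real E) - infsum c E\<bar> \<le> 0 + e" if "e > 0" for e
        proof -
          \<comment> \<open>\<open>S\<close> will carry all but \<open>e / 2\<close> of the absolute
            mass of \<open>E - {x}\<close>.\<close>
          have "((\<lambda>y. \<bar>c y\<bar>) has_sum infsum (\<lambda>y. \<bar>c y\<bar>) (E - {x})) (E - {x})"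
            using sub by (intro has_sum_infsum abs_summable_sub) auto
          then obtain S where S: "finite S" "S \<subseteq> E - {x}"
            "dist (\<Sum>y\<in>S. \<bar>c y\<bar>) (infsum (\<lambda>y. \<bar>c y\<bar>) (E - {x})) \<le> e / 2"
            using has_sum_finite_approximation[of _ _ _ "e / 2"] \<open>e > 0\<close> by (metis half_gt_zero)
          have "\<Union>((\<lambda>y. X closure_of {y}) ` S) \<in> proper_closed X x"
          proof (rule proper_closed_Union)
            have "X closure_of {y} \<in> proper_closed X x" if "y \<in> S" for y
            proof -
              have y: "y \<in> E" "y \<noteq> x"
                using that S by auto
              then have le: "X closure_of {y} \<subseteq> E"
                using closure_of_minimal[of "{y}" E X] less.prems by simp
              \<comment> \<open>Otherwise \<open>y\<close> would be a second generic point of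
                \<open>E\<close>.\<close>
              moreover have "x \<notin> X closure_of {y}"
              proof
                assume "x \<in> X closure_of {y}"
                then have "E \<subseteq> X closure_of {y}"
                  unfolding x(2)[symmetric] by (intro closure_of_minimal) auto
                then show False
                  using le y ex1 x by blast
              qed
              ultimately show ?thesis
                by (simp add: proper_closed_def x)
            qed
            then show "(\<lambda>y. X closure_of {y}) ` S \<subseteq> proper_closed X x"
              by blast
          qed (use S in simp)
          \<comment> \<open>A closed \<open>G\<close> that contains \<open>S\<close>, misses
            \<open>x\<close> and nearly realizes \<open>c x\<close>; being smaller than
            \<open>E\<close>, it is subject to the induction hypothesis.\<close>
          then obtain G where G: "G \<in> proper_closed X x" "\<Union>((\<lambda>y. X closure_of {y}) ` S) \<subseteq> G"
            "\<bar>\<phi> (indicat_real E) - \<phi> (indicat_real G) - c x\<bar> < e / 2"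
            using is_point_massE[OF c, of x "e / 2"] sub x \<open>e > 0\<close> by (metis half_gt_zero subsetD)
          have G': "closedin X G" "G \<subset> E" "G \<subseteq> E - {x}"
            using G(1) x by (auto simp: proper_closed_def)
          have "S \<subseteq> G"
          proof
            fix y assume "y \<in> S"
            then have "y \<in> X closure_of {y}"
              using S sub by (intro mem_closure_of_point) auto
            then show "y \<in> G"
              using \<open>y \<in> S\<close> G(2) by blast
          qed
          have "E - {x} = G \<union> (E - {x} - G)"
            using G' by auto
          then have split: "infsum c (E - {x}) = infsum c G + infsum c (E - {x} - G)"
            using G' sub by (metis Diff_disjoint Diff_subset infsum_Un_disjoint summable_sub order_trans)
          \<comment> \<open>What \<open>G\<close> leaves out of \<open>E - {x}\<close> avoids
            \<open>S\<close>, so its mass is at most \<open>e / 2\<close>; with the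
            \<open>e / 2\<close> from the choice of \<open>G\<close> the total error is at most
            \<open>e\<close>.\<close>
          have "\<bar>infsum c (E - {x} - G)\<bar> \<le> infsum (\<lambda>y. \<bar>c y\<bar>) (E - {x} - G)"
            using norm_infsum_bound[of c "E - {x} - G"] abs_summable_sub[of "E - {x} - G"] sub by auto
          also have "\<dots> \<le> infsum (\<lambda>y. \<bar>c y\<bar>) (E - {x} - S)"
            using sub \<open>S \<subseteq> G\<close> by (intro infsum_mono2 abs_summable_sub) auto
          also have "\<dots> = infsum (\<lambda>y. \<bar>c y\<bar>) (E - {x}) - (\<Sum>y\<in>S. \<bar>c y\<bar>)"
          proof -
            have "infsum (\<lambda>y. \<bar>c y\<bar>) (S \<union> (E - {x} - S)) =
                infsum (\<lambda>y. \<bar>c y\<bar>) S + infsum (\<lambda>y. \<bar>c y\<bar>) (E - {x} - S)"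
              using sub S by (intro infsum_Un_disjoint abs_summable_sub) auto
            moreover have "S \<union> (E - {x} - S) = E - {x}"
              using S by auto
            ultimately show ?thesis
              using S by simp
          qed
          also have "\<dots> \<le> e / 2"
            using S(3) unfolding dist_real_def by linarith
          finally have tail: "\<bar>infsum c (E - {x} - G)\<bar> \<le> e / 2" .
          have "infsum c (insert x (E - {x})) = c x + infsum c (E - {x})"
            using sub by (intro infsum_insert summable_sub) auto
          then have "infsum c E = c x + infsum c (E - {x})"
            using x(1) by (simp add: insert_absorb)
          then show ?thesis
            using split tail G(3) IH[OF G'(1,2)] by linarith
        qed
        then have "\<bar>\<phi> (indicat_real E) - infsum c E\<bar> \<le> 0"
          by (rule field_le_epsilon)
        then show ?thesis
          by simp
      qed
    qed
  qed
qed

section \<open>Atomic measures and surjectivity\<close>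

lemma atomic_signed_measure:
  fixes c :: "'a \<Rightarrow> real"
  assumes c: "c summable_on topspace X"
  shows "(\<lambda>A. if A \<in> borel_sets X then infsum c A else 0) \<in> signed_measures X"
proof -
  interpret sigma_algebra "topspace X" "borel_sets X"
    by (rule sigma_algebra_borel_sets)
  have "(\<lambda>n. infsum c (A n)) sums infsum c (\<Union>n. A n)"
    if A: "range A \<subseteq> borel_sets X" "disjoint_family A" for A :: "nat \<Rightarrow> 'a set"
  proof -
    have sub: "(\<Union>n. A n) \<subseteq> topspace X"
      using A(1) sets_into_space by blast
    \<comment> \<open>Disjointness lets a point determine its index, so the sum over the union can
      be indexed by \<open>Sigma UNIV A\<close> and then summed set by set.\<close>
    have inj: "inj_on snd (Sigma UNIV A)"
    proof (rule inj_onI, clarsimp)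
      fix m n x assume "x \<in> A m" "x \<in> A n"
      then show "m = n"
        using disjoint_family_onD[OF A(2), of m n] by (cases "m = n") auto
    qed
    have img: "snd ` Sigma UNIV A = (\<Union>n. A n)"
      by force
    have "c summable_on (\<Union>n. A n)"
      by (rule summable_on_subset_banach[OF c sub])
    then have summ: "(c \<circ> snd) summable_on Sigma UNIV A"
      unfolding img[symmetric] summable_on_reindex[OF inj] .
    have "((\<lambda>n. infsum c (A n)) has_sum infsum (c \<circ> snd) (Sigma UNIV A)) UNIV"
    proof (rule has_sum_SigmaD[OF has_sum_infsum[OF summ]])
      fix n :: nat
      have "A n \<subseteq> topspace X"
        using order_trans[OF UN_upper sub] by simp
      then show "((\<lambda>y. (c \<circ> snd) (n, y)) has_sum infsum c (A n)) (A n)"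
        using summable_on_subset_banach[OF c] by simp
    qed
    also have "infsum (c \<circ> snd) (Sigma UNIV A) = infsum c (\<Union>n. A n)"
      unfolding img[symmetric] infsum_reindex[OF inj] ..
    finally show ?thesis
      by (rule has_sum_imp_sums)
  qed
  then show ?thesis
    unfolding signed_measures_def by (auto simp: image_subset_iff countable_UN)
qed

text \<open>Integration against the atomic measure with masses \<open>c\<close> agrees with
  \<open>\<phi>\<close> on indicators of closed sets, and these determine a functional.\<close>

lemma Lambda_surj:
  assumes X: "zariski_space X" and \<phi>: "\<phi> \<in> SC_dual X"
  shows "\<phi> \<in> Lambda X ` signed_measures X"
proof -
  obtain c where c: "is_point_mass X \<phi> c"
    using ex_point_mass[OF \<phi>] by blast
  let ?\<mu> = "\<lambda>A. if A \<in> borel_sets X then infsum c A else 0"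
  have \<mu>: "?\<mu> \<in> signed_measures X"
    by (rule atomic_signed_measure[OF point_mass_summable[OF X \<phi> c]])
  have "\<phi> = Lambda X ?\<mu>"
    by (rule SC_dual_eqI[OF \<phi> Lambda_in_SC_dual[OF \<mu>]])
      (simp add: Lambda_indicator[OF \<mu>] infsum_point_mass[OF X \<phi> c] borel_sets_closedin)
  then show ?thesis
    using \<mu> by blast
qed

theorem theoremB:
  fixes X :: "'a topology"
  assumes "zariski_space X"
  shows "real_linear_iso (signed_measures X) (SC_dual X) (Lambda X)"
  unfolding real_linear_iso_def bij_betw_def
  using assms real_fun_space_signed_measures real_fun_space_SC_dual inj_on_Lambda
  by (auto simp: Lambda_add Lambda_cmult intro: Lambda_in_SC_dual Lambda_surj)

end
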